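(* Let $L$ be a Lorentz-Finsler metric on $A$ and $n\ge 3$. If $\mathrm{N}=\mathrm{N}^L+\dot\partial\mathcal{Z}$, with $\mathcal{Z}\in\mathrm{h}^2\mathcal{T}^1_0(M_A)$, is a symmetric proper solution of the affine equation of $L$ and $$2\,\mathrm{C}_{a\cdot i}\,\mathcal{Z}^a+\mathrm{C}_a\,\mathcal{Z}^a_{\cdot i}+\mathrm{Lan}_i=0,$$ then $\mathcal{Z}=0$ and thus $\mathrm{Lan}_i=0$.
   Context: $M$ is a connected smooth manifold of dimension $n$, $\pi:TM\to M$ the projection. Charts $(x^i)$ of $M$ induce charts $(x^i,y^i)$ of $TM$; $\partial_i=\partial/\partial x^i$, $\dot\partial_i=\partial/\partial y^i$; repeated indices are summed. $A\subseteq TM\setminus\mathbf{0}$ is open and conic ($\lambda v\in A$ for $v\in A$, $\lambda>0$) with $\pi(A)=M$; $A_p=A\cap T_pM$; $\overline A$ is the closure of $A$ in $TM\setminus\mathbf 0$, $\partial A=\overline A\setminus A$. An anisotropic tensor of type $(r,s)$ is a smooth section of the pullback to $A$ of $\bigotimes^rTM\otimes\bigotimes^sT^*M$, with components $T^{i_1\dots i_r}_{j_1\dots j_s}(x,y)$; the space of those with components positively $\alpha$-homogeneous in $y$ is $\mathrm{h}^\alpha\mathcal{T}^r_s(M_A)$. A subscript $\cdot i$ denotes $\dot\partial_i$; $(\dot\partial\mathcal{Z})_i^k=\mathcal{Z}^k_{\cdot i}$. A homogeneous nonlinear connection $\mathrm{N}$ on $A$ is given in each chart by smooth functions $\mathrm{N}_i^k(x,y)$,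 positively $1$-homogeneous in $y$, transforming by $\bar{\mathrm{N}}_i^k=\frac{\partial\bar x^k}{\partial x^c}\frac{\partial^2x^c}{\partial\bar x^i\partial\bar x^b}\bar y^b+\frac{\partial\bar x^k}{\partial x^c}\frac{\partial x^a}{\partial\bar x^i}\mathrm{N}_a^c$. Differences of two such lie in $\mathrm{h}^1\mathcal{T}^1_1(M_A)$. $\mathrm{N}$ is symmetric if $\mathrm{N}^k_{i\cdot j}=\mathrm{N}^k_{j\cdot i}$. A pseudo-Finsler metric on $A$ is a smooth positively $2$-homogeneous $L:A\to\mathbb{R}$ with $g_{ij}=\frac12L_{\cdot i\cdot j}$ non-degenerate everywhere. It is proper if (i) each $A_p$ is connected and $L>0$ on $A$, and (ii) $L$ extends smoothly to $\overline A$ with $L=0$ and $g$ non-degenerate on $\partial A$. It is Lorentz-Finsler if it is proper and $g$ has signature $(+,-,\dots,-)$. Indices are moved with $g$; $y_i=g_{ia}y^a$. $(\mathrm{G}^L)^i=\frac14g^{ia}(2\partial_cg_{ab}-\partial_ag_{bc})y^by^c$; $(\mathrm{N}^L)_i^k=\dot\partial_i(\mathrm{G}^L)^k$. $\mathrm{C}_{ijk}=\frac12g_{ij\cdot k}$, $\mathrm{C}_i=g^{ab}\mathrm{C}_{abi}$. $\mathrm{Lan}_{ijk}=\frac12\nabla^L_kg_{ij}$ with $\nabla^L_kg_{ij}=(\partial_k-(\mathrm{N}^L)_k^a\dot\partial_a)g_{ij}-(\mathrm{N}^L)^a_{k\cdot i}g_{aj}-(\mathrm{N}^L)^a_{k\cdot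 j}g_{ia}$, $\mathrm{Lan}_i=g^{ab}\mathrm{Lan}_{abi}$. $\mathrm{N}=\mathrm{N}^L+\mathcal{J}$, $\mathcal{J}\in\mathrm{h}^1\mathcal{T}^1_1(M_A)$, is a solution of the affine equation of $L$ if on $A$ $$\Big\{2\mathrm{Lan}_b+(n+2)\tfrac{y_a}{L}\mathcal{J}^a_b-2\mathrm{C}_a\mathcal{J}^a_b-(\mathcal{J}^a_{b\cdot a}+\mathcal{J}^a_{a\cdot b})\Big\}(\delta^b_iy^j-y^b\delta^j_i)-(\mathcal{J}^j_{i\cdot a}-\mathcal{J}^j_{a\cdot i})y^a=0 ;$$ it is a proper solution if moreover $\mathrm{N}$ extends smoothly to $\overline A$. *)

theory Defs
  imports "HOL-Analysis.Analysis"
begin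

subsection \<open>Smooth maps between Euclidean spaces\<close>

text \<open>Meant for open \<open>S\<close>. As the domain is finite-dimensional, it suffices to
  require class \<open>k\<close> of each directional derivative for \<open>f\<close> to be of class \<open>k + 1\<close>.\<close>

fun Ck_on :: "nat \<Rightarrow> ('a::euclidean_space \<Rightarrow> 'b::real_normed_vector) \<Rightarrow> 'a set \<Rightarrow> bool" where
  "Ck_on 0 f S \<longleftrightarrow> continuous_on S f"
| "Ck_on (Suc k) f S \<longleftrightarrow>
     (\<forall>x\<in>S. f differentiable (at x)) \<and> (\<forall>v. Ck_on k (\<lambda>x. frechet_derivative f (at x) v) S)"

definition smooth_on :: "('a::euclidean_space \<Rightarrow> 'b::real_normed_vector) \<Rightarrow> 'a set \<Rightarrow> bool" where
  "smooth_on f S \<longleftrightarrow> (\<forall>k. Ck_on k f S)"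

subsection \<open>Smooth manifolds\<close>

text \<open>The manifold is the whole type \<open>'m\<close>; its dimension is \<open>CARD('n)\<close>. A chart is a pair of its
  domain and a map whose values outside the domain are irrelevant. An atlas need not be maximal.\<close>

type_synonym ('m, 'n) chart = "'m set \<times> ('m \<Rightarrow> real ^ 'n)"

definition transition :: "('m, 'n) chart \<Rightarrow> ('m, 'n) chart \<Rightarrow> real ^ 'n \<Rightarrow> real ^ 'n" where
  "transition \<phi> \<psi> = snd \<psi> \<circ> inv_into (fst \<phi>) (snd \<phi>)"

definition smooth_atlas :: "('m::topological_space, 'n::finite) chart set \<Rightarrow> bool" where
  "smooth_atlas \<A> \<longleftrightarrow>
     (\<Union>\<phi>\<in>\<A>. fst \<phi>) = UNIV \<and>
     (\<forall>\<phi>\<in>\<A>. open (fst \<phi>) \<and> open (snd \<phi> ` fst \<phi>) \<and>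
        homeomorphism (fst \<phi>) (snd \<phi> ` fst \<phi>) (snd \<phi>) (inv_into (fst \<phi>) (snd \<phi>))) \<and>
     (\<forall>\<phi>\<in>\<A>. \<forall>\<psi>\<in>\<A>. smooth_on (transition \<phi> \<psi>) (snd \<phi> ` (fst \<phi> \<inter> fst \<psi>)))"

text \<open>\<open>trans_jac \<phi> \<psi> p $ k $ a\<close> is $\partial \bar x^k/\partial x^a$ at \<open>p\<close> and
  \<open>trans_hess \<phi> \<psi> p k a b\<close> is $\partial^2 \bar x^k/\partial x^a\partial x^b$ at \<open>p\<close>, where
  $x$ are the coordinates of \<open>\<phi>\<close> and $\bar x$ those of \<open>\<psi>\<close>.\<close>

definition trans_jac ::
  "('m, 'n::finite) chart \<Rightarrow> ('m, 'n) chart \<Rightarrow> 'm \<Rightarrow> real ^ 'n ^ 'n" where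
  "trans_jac \<phi> \<psi> p = jacobian (transition \<phi> \<psi>) (at (snd \<phi> p))"

definition trans_hess ::
  "('m, 'n::finite) chart \<Rightarrow> ('m, 'n) chart \<Rightarrow> 'm \<Rightarrow> 'n \<Rightarrow> 'n \<Rightarrow> 'n \<Rightarrow> real" where
  "trans_hess \<phi> \<psi> p k a b =
     frechet_derivative (\<lambda>u. jacobian (transition \<phi> \<psi>) (at u) $ k $ b) (at (snd \<phi> p)) (axis a 1)"

subsection \<open>The tangent bundle\<close>

text \<open>A tangent vector at \<open>p\<close> is the family of its component vectors in all charts around \<open>p\<close>,
  related by the Jacobians of the transition maps. Entries at all other pairs of sets and maps
  are normalised to 0.\<close>

type_synonym ('m, 'n) tvec = "'m \<times> (('m, 'n) chart \<Rightarrow> real ^ 'n)"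

definition tangent_bundle :: "('m, 'n::finite) chart set \<Rightarrow> ('m, 'n) tvec set" where
  "tangent_bundle \<A> =
     {(p, v). (\<forall>\<phi>. \<not> (\<phi> \<in> \<A> \<and> p \<in> fst \<phi>) \<longrightarrow> v \<phi> = 0) \<and>
        (\<forall>\<phi>\<in>\<A>. \<forall>\<psi>\<in>\<A>. p \<in> fst \<phi> \<inter> fst \<psi> \<longrightarrow> v \<psi> = trans_jac \<phi> \<psi> p *v v \<phi>)}"

definition slit_tangent_bundle :: "('m, 'n::finite) chart set \<Rightarrow> ('m, 'n) tvec set" where
  "slit_tangent_bundle \<A> = {v \<in> tangent_bundle \<A>. snd v \<noteq> (\<lambda>\<phi>. 0)}"

definition scale_tvec :: "real \<Rightarrow> ('m, 'n::finite) tvec \<Rightarrow> ('m, 'n) tvec" where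
  "scale_tvec t v = (fst v, \<lambda>\<phi>. t *\<^sub>R snd v \<phi>)"

text \<open>The chart $(x^i, y^i)$ of the tangent bundle induced by \<open>\<phi>\<close>, and the coordinate expression
  of the part of \<open>W\<close> over the domain of \<open>\<phi>\<close>.\<close>

definition tchart :: "('m, 'n) chart \<Rightarrow> ('m, 'n) tvec \<Rightarrow> (real ^ 'n) \<times> (real ^ 'n)" where
  "tchart \<phi> v = (snd \<phi> (fst v), snd v \<phi>)"

definition region ::
  "('m, 'n) chart \<Rightarrow> ('m, 'n) tvec set \<Rightarrow> ((real ^ 'n) \<times> (real ^ 'n)) set" where
  "region \<phi> W = tchart \<phi> ` {v \<in> W. fst v \<in> fst \<phi>}"

definition tangent_topology :: "('m, 'n::finite) chart set \<Rightarrow> ('m, 'n) tvec topology" where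
  "tangent_topology \<A> =
     topology (\<lambda>W. W \<subseteq> tangent_bundle \<A> \<and> (\<forall>\<phi>\<in>\<A>. open (region \<phi> W)))"

lemma tvec_eqI:
  assumes v: "v \<in> tangent_bundle \<A>" and w: "w \<in> tangent_bundle \<A>" and "\<phi> \<in> \<A>"
    and p: "fst v = fst w" "fst v \<in> fst \<phi>" and eq: "snd v \<phi> = snd w \<phi>"
  shows "v = w"
proof -
  have trans: "snd u \<psi> = trans_jac \<phi> \<psi> (fst u) *v snd u \<phi>"
    if "u \<in> tangent_bundle \<A>" "\<psi> \<in> \<A>" "fst u \<in> fst \<phi>" "fst u \<in> fst \<psi>" for u \<psi>
    using that \<open>\<phi> \<in> \<A>\<close> unfolding tangent_bundle_def case_prod_beta mem_Collect_eq by blast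
  have zero: "snd u \<psi> = 0"
    if "u \<in> tangent_bundle \<A>" "\<not> (\<psi> \<in> \<A> \<and> fst u \<in> fst \<psi>)" for u \<psi>
    using that unfolding tangent_bundle_def case_prod_beta mem_Collect_eq by blast
  have "snd v \<psi> = snd w \<psi>" for \<psi>
  proof (cases "\<psi> \<in> \<A> \<and> fst v \<in> fst \<psi>")
    case True
    then show ?thesis using trans[OF v, of \<psi>] trans[OF w, of \<psi>] p eq by simp
  next
    case False
    then show ?thesis using zero[OF v, of \<psi>] zero[OF w, of \<psi>] p by simp
  qed
  then show ?thesis using p(1) by (simp add: prod_eq_iff fun_eq_iff)
qed

lemma inj_on_tchart:
  assumes "smooth_atlas \<A>" "\<phi> \<in> \<A>"
  shows "inj_on (tchart \<phi>) {v \<in> tangent_bundle \<A>. fst v \<in> fst \<phi>}"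
proof (rule inj_onI)
  fix v w
  assume v: "v \<in> {v \<in> tangent_bundle \<A>. fst v \<in> fst \<phi>}"
    and w: "w \<in> {v \<in> tangent_bundle \<A>. fst v \<in> fst \<phi>}" and eq: "tchart \<phi> v = tchart \<phi> w"
  have "homeomorphism (fst \<phi>) (snd \<phi> ` fst \<phi>) (snd \<phi>) (inv_into (fst \<phi>) (snd \<phi>))"
    using assms unfolding smooth_atlas_def by blast
  then have inv: "inv_into (fst \<phi>) (snd \<phi>) (snd \<phi> p) = p" if "p \<in> fst \<phi>" for p
    using that by (rule homeomorphism_apply1)
  have "snd \<phi> (fst v) = snd \<phi> (fst w)" "snd v \<phi> = snd w \<phi>"
    using eq by (simp_all add: tchart_def)
  moreover from this have "fst v = fst w"
    using inv[of "fst v"] inv[of "fst w"] v w by (metis (no_types, lifting) mem_Collect_eq)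
  ultimately show "v = w"
    using v w assms(2) by (intro tvec_eqI[of v \<A> w \<phi>]) blast+
qed

lemma openin_tangent_topology:
  assumes "smooth_atlas \<A>"
  shows "openin (tangent_topology \<A>) W \<longleftrightarrow>
    W \<subseteq> tangent_bundle \<A> \<and> (\<forall>\<phi>\<in>\<A>. open (region \<phi> W))"
proof -
  have "istopology (\<lambda>W. W \<subseteq> tangent_bundle \<A> \<and> (\<forall>\<phi>\<in>\<A>. open (region \<phi> W)))"
    unfolding istopology_def
  proof (intro conjI allI impI)
    fix S T
    assume S: "S \<subseteq> tangent_bundle \<A> \<and> (\<forall>\<phi>\<in>\<A>. open (region \<phi> S))"
      and T: "T \<subseteq> tangent_bundle \<A> \<and> (\<forall>\<phi>\<in>\<A>. open (region \<phi> T))"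
    show "S \<inter> T \<subseteq> tangent_bundle \<A>" using S by blast
    have "region \<phi> (S \<inter> T) = region \<phi> S \<inter> region \<phi> T" if "\<phi> \<in> \<A>" for \<phi>
    proof -
      have "tchart \<phi> ` ({v \<in> S. fst v \<in> fst \<phi>} \<inter> {v \<in> T. fst v \<in> fst \<phi>})
          = tchart \<phi> ` {v \<in> S. fst v \<in> fst \<phi>} \<inter> tchart \<phi> ` {v \<in> T. fst v \<in> fst \<phi>}"
        using S T by (intro inj_on_image_Int[OF inj_on_tchart[OF assms that]]) blast+
      moreover have "{v \<in> S \<inter> T. fst v \<in> fst \<phi>}
          = {v \<in> S. fst v \<in> fst \<phi>} \<inter> {v \<in> T. fst v \<in> fst \<phi>}" by blast
      ultimately show ?thesis by (simp only: region_def)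
    qed
    then show "\<forall>\<phi>\<in>\<A>. open (region \<phi> (S \<inter> T))" using S T by auto
  next
    fix \<K>
    assume K: "\<forall>W\<in>\<K>. W \<subseteq> tangent_bundle \<A> \<and> (\<forall>\<phi>\<in>\<A>. open (region \<phi> W))"
    show "\<Union>\<K> \<subseteq> tangent_bundle \<A>" using K by blast
    have "region \<phi> (\<Union>\<K>) = (\<Union>W\<in>\<K>. region \<phi> W)" for \<phi>
      by (auto simp: region_def)
    then show "\<forall>\<phi>\<in>\<A>. open (region \<phi> (\<Union>\<K>))" using K by auto
  qed
  then show ?thesis by (simp add: tangent_topology_def topology_inverse')
qed

definition cone_domain ::
  "('m, 'n::finite) chart set \<Rightarrow> ('m, 'n) tvec set \<Rightarrow> bool" where
  "cone_domain \<A> A \<longleftrightarrow>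
     openin (tangent_topology \<A>) A \<and> A \<subseteq> slit_tangent_bundle \<A> \<and>
     (\<forall>v\<in>A. \<forall>t>0. scale_tvec t v \<in> A) \<and> fst ` A = UNIV"

definition slit_closure ::
  "('m, 'n::finite) chart set \<Rightarrow> ('m, 'n) tvec set \<Rightarrow> ('m, 'n) tvec set" where
  "slit_closure \<A> A = (tangent_topology \<A> closure_of A) \<inter> slit_tangent_bundle \<A>"

definition slit_boundary ::
  "('m, 'n::finite) chart set \<Rightarrow> ('m, 'n) tvec set \<Rightarrow> ('m, 'n) tvec set" where
  "slit_boundary \<A> A = slit_closure \<A> A - A"

text \<open>The coordinate expression of a function on a part of the tangent bundle.\<close>

definition local_expr ::
  "('m, 'n::finite) chart set \<Rightarrow> ('m, 'n) chart \<Rightarrow> (('m, 'n) tvec \<Rightarrow> 'b)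
     \<Rightarrow> (real ^ 'n) \<times> (real ^ 'n) \<Rightarrow> 'b" where
  "local_expr \<A> \<phi> f z =
     f (inv_into {v \<in> tangent_bundle \<A>. fst v \<in> fst \<phi>} (tchart \<phi>) z)"

definition smooth_fun ::
  "('m, 'n::finite) chart set \<Rightarrow> ('m, 'n) tvec set \<Rightarrow> (('m, 'n) tvec \<Rightarrow> real) \<Rightarrow> bool" where
  "smooth_fun \<A> W f \<longleftrightarrow> (\<forall>\<phi>\<in>\<A>. smooth_on (local_expr \<A> \<phi> f) (region \<phi> W))"

subsection \<open>Coordinate calculus\<close>

text \<open>Here a point of a chart of the tangent bundle is a pair \<open>z = (x, y)\<close>, and \<open>F\<close> is the coordinate
  expression of a pseudo-Finsler metric. The first index argument of a mixed tensor or connection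
  is the upper one: \<open>N k i\<close> is $N^k_i$.\<close>

type_synonym 'n fld = "(real ^ 'n) \<times> (real ^ 'n) \<Rightarrow> real"

definition dx :: "'n::finite \<Rightarrow> 'n fld \<Rightarrow> 'n fld" where
  "dx i f z = frechet_derivative f (at z) (axis i 1, 0)"

definition dy :: "'n::finite \<Rightarrow> 'n fld \<Rightarrow> 'n fld" where
  "dy i f z = frechet_derivative f (at z) (0, axis i 1)"

definition gmat :: "'n::finite fld \<Rightarrow> (real ^ 'n) \<times> (real ^ 'n) \<Rightarrow> real ^ 'n ^ 'n" where
  "gmat F z = (\<chi> i j. 1/2 * dy j (dy i F) z)"

definition g_lo :: "'n::finite fld \<Rightarrow> 'n \<Rightarrow> 'n \<Rightarrow> 'n fld" where
  "g_lo F i j z = gmat F z $ i $ j"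

definition g_up :: "'n::finite fld \<Rightarrow> 'n \<Rightarrow> 'n \<Rightarrow> 'n fld" where
  "g_up F i j z = matrix_inv (gmat F z) $ i $ j"

definition y_lo :: "'n::finite fld \<Rightarrow> 'n \<Rightarrow> 'n fld" where
  "y_lo F i z = (\<Sum>a\<in>UNIV. g_lo F i a z * snd z $ a)"

definition spray :: "'n::finite fld \<Rightarrow> 'n \<Rightarrow> 'n fld" where
  "spray F i z = 1/4 * (\<Sum>a\<in>UNIV. \<Sum>b\<in>UNIV. \<Sum>c\<in>UNIV.
     g_up F i a z * (2 * dx c (g_lo F a b) z - dx a (g_lo F b c) z) * snd z $ b * snd z $ c)"

definition conn :: "'n::finite fld \<Rightarrow> 'n \<Rightarrow> 'n \<Rightarrow> 'n fld" where
  "conn F k i = dy i (spray F k)"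

definition cartan :: "'n::finite fld \<Rightarrow> 'n \<Rightarrow> 'n \<Rightarrow> 'n \<Rightarrow> 'n fld" where
  "cartan F i j k z = 1/2 * dy k (g_lo F i j) z"

definition mean_cartan :: "'n::finite fld \<Rightarrow> 'n \<Rightarrow> 'n fld" where
  "mean_cartan F i z = (\<Sum>a\<in>UNIV. \<Sum>b\<in>UNIV. g_up F a b z * cartan F a b i z)"

text \<open>\<open>nabla_g F k i j\<close> is $\nabla^L_k g_{ij}$.\<close>

definition nabla_g :: "'n::finite fld \<Rightarrow> 'n \<Rightarrow> 'n \<Rightarrow> 'n \<Rightarrow> 'n fld" where
  "nabla_g F k i j z =
     (dx k (g_lo F i j) z - (\<Sum>a\<in>UNIV. conn F a k z * dy a (g_lo F i j) z))
     - (\<Sum>a\<in>UNIV. dy i (conn F a k) z * g_lo F a j z)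
     - (\<Sum>a\<in>UNIV. dy j (conn F a k) z * g_lo F i a z)"

definition landsberg :: "'n::finite fld \<Rightarrow> 'n \<Rightarrow> 'n \<Rightarrow> 'n \<Rightarrow> 'n fld" where
  "landsberg F i j k z = 1/2 * nabla_g F k i j z"

definition mean_landsberg :: "'n::finite fld \<Rightarrow> 'n \<Rightarrow> 'n fld" where
  "mean_landsberg F i z = (\<Sum>a\<in>UNIV. \<Sum>b\<in>UNIV. g_up F a b z * landsberg F a b i z)"

definition kdelta :: "'n \<Rightarrow> 'n \<Rightarrow> real" where
  "kdelta i j = (if i = j then 1 else 0)"

text \<open>The factor in braces (with free index \<open>b\<close>) of the affine equation.\<close>

definition affine_covector ::
  "'n::finite fld \<Rightarrow> ('n \<Rightarrow> 'n \<Rightarrow> 'n fld) \<Rightarrow> 'n \<Rightarrow> 'n fld" where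
  "affine_covector F J b z =
     2 * mean_landsberg F b z
     + (real CARD('n) + 2) * (\<Sum>a\<in>UNIV. y_lo F a z / F z * J a b z)
     - 2 * (\<Sum>a\<in>UNIV. mean_cartan F a z * J a b z)
     - (\<Sum>a\<in>UNIV. dy a (J a b) z + dy b (J a a) z)"

definition affine_equation_at ::
  "'n::finite fld \<Rightarrow> ('n \<Rightarrow> 'n \<Rightarrow> 'n fld) \<Rightarrow> (real ^ 'n) \<times> (real ^ 'n) \<Rightarrow> bool" where
  "affine_equation_at F J z \<longleftrightarrow> (\<forall>i j.
     (\<Sum>b\<in>UNIV. affine_covector F J b z * (kdelta b i * snd z $ j - snd z $ b * kdelta j i))
     - (\<Sum>a\<in>UNIV. (dy a (J j i) z - dy i (J j a) z) * snd z $ a) = 0)"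

subsection \<open>Pseudo-Finsler metrics\<close>

definition pseudo_finsler ::
  "('m, 'n::finite) chart set \<Rightarrow> ('m, 'n) tvec set \<Rightarrow> (('m, 'n) tvec \<Rightarrow> real) \<Rightarrow> bool" where
  "pseudo_finsler \<A> A L \<longleftrightarrow>
     smooth_fun \<A> A L \<and>
     (\<forall>v\<in>A. \<forall>t>0. L (scale_tvec t v) = t\<^sup>2 * L v) \<and>
     (\<forall>\<phi>\<in>\<A>. \<forall>z\<in>region \<phi> A. invertible (gmat (local_expr \<A> \<phi> L) z))"

text \<open>Smooth extension to the closure means extension to a smooth function \<open>L'\<close> on an open
  neighbourhood \<open>A'\<close> of it; on the boundary, \<open>g\<close> is computed from \<open>L'\<close>.\<close>

definition proper_finsler ::
  "('m, 'n::finite) chart set \<Rightarrow> ('m, 'n) tvec set \<Rightarrow> (('m, 'n) tvec \<Rightarrow> real) \<Rightarrow> bool" where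
  "proper_finsler \<A> A L \<longleftrightarrow>
     pseudo_finsler \<A> A L \<and>
     (\<forall>p. connectedin (tangent_topology \<A>) {v \<in> A. fst v = p}) \<and>
     (\<forall>v\<in>A. L v > 0) \<and>
     (\<exists>A' L'. openin (tangent_topology \<A>) A' \<and> slit_closure \<A> A \<subseteq> A' \<and>
        A' \<subseteq> slit_tangent_bundle \<A> \<and> smooth_fun \<A> A' L' \<and> (\<forall>v\<in>A. L' v = L v) \<and>
        (\<forall>v\<in>slit_boundary \<A> A. L' v = 0) \<and>
        (\<forall>\<phi>\<in>\<A>. \<forall>z\<in>region \<phi> (slit_boundary \<A> A). invertible (gmat (local_expr \<A> \<phi> L') z)))"

text \<open>Signature $(+,-,\dots,-)$ of a symmetric bilinear form, given by its matrix.\<close>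

definition lorentzian :: "real ^ 'n ^ 'n::finite \<Rightarrow> bool" where
  "lorentzian G \<longleftrightarrow> (\<exists>(P :: real ^ 'n ^ 'n) k. invertible P \<and>
     transpose P ** G ** P = (\<chi> i j. if i = j then (if i = k then 1 else -1) else 0))"

definition lorentz_finsler ::
  "('m, 'n::finite) chart set \<Rightarrow> ('m, 'n) tvec set \<Rightarrow> (('m, 'n) tvec \<Rightarrow> real) \<Rightarrow> bool" where
  "lorentz_finsler \<A> A L \<longleftrightarrow>
     proper_finsler \<A> A L \<and>
     (\<forall>\<phi>\<in>\<A>. \<forall>z\<in>region \<phi> A. lorentzian (gmat (local_expr \<A> \<phi> L) z))"

subsection \<open>Anisotropic tensors and nonlinear connections\<close>

text \<open>These are given by their component functions in each chart of the atlas; values outside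
  \<open>region \<phi> A\<close> are irrelevant.\<close>

definition pos_homogeneous ::
  "nat \<Rightarrow> ((real ^ 'n) \<times> (real ^ 'n)) set \<Rightarrow> 'n::finite fld \<Rightarrow> bool" where
  "pos_homogeneous \<alpha> W f \<longleftrightarrow> (\<forall>(x, y)\<in>W. \<forall>t>0. f (x, t *\<^sub>R y) = t ^ \<alpha> * f (x, y))"

definition aniso_vector ::
  "('m, 'n::finite) chart set \<Rightarrow> ('m, 'n) tvec set \<Rightarrow> nat
     \<Rightarrow> (('m, 'n) chart \<Rightarrow> 'n \<Rightarrow> 'n fld) \<Rightarrow> bool" where
  "aniso_vector \<A> A \<alpha> Z \<longleftrightarrow>
     (\<forall>\<phi>\<in>\<A>. \<forall>k. smooth_on (Z \<phi> k) (region \<phi> A) \<and> pos_homogeneous \<alpha> (region \<phi> A) (Z \<phi> k)) \<and>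
     (\<forall>\<phi>\<in>\<A>. \<forall>\<psi>\<in>\<A>. \<forall>v\<in>A. fst v \<in> fst \<phi> \<inter> fst \<psi> \<longrightarrow> (\<forall>k.
        Z \<psi> k (tchart \<psi> v)
          = (\<Sum>a\<in>UNIV. trans_jac \<phi> \<psi> (fst v) $ k $ a * Z \<phi> a (tchart \<phi> v))))"

definition aniso_endo ::
  "('m, 'n::finite) chart set \<Rightarrow> ('m, 'n) tvec set \<Rightarrow> nat
     \<Rightarrow> (('m, 'n) chart \<Rightarrow> 'n \<Rightarrow> 'n \<Rightarrow> 'n fld) \<Rightarrow> bool" where
  "aniso_endo \<A> A \<alpha> J \<longleftrightarrow>
     (\<forall>\<phi>\<in>\<A>. \<forall>k i. smooth_on (J \<phi> k i) (region \<phi> A) \<and>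
        pos_homogeneous \<alpha> (region \<phi> A) (J \<phi> k i)) \<and>
     (\<forall>\<phi>\<in>\<A>. \<forall>\<psi>\<in>\<A>. \<forall>v\<in>A. fst v \<in> fst \<phi> \<inter> fst \<psi> \<longrightarrow> (\<forall>k i.
        J \<psi> k i (tchart \<psi> v)
          = (\<Sum>c\<in>UNIV. \<Sum>a\<in>UNIV. trans_jac \<phi> \<psi> (fst v) $ k $ c
               * trans_jac \<psi> \<phi> (fst v) $ a $ i * J \<phi> c a (tchart \<phi> v))))"

definition nonlinear_connection ::
  "('m, 'n::finite) chart set \<Rightarrow> ('m, 'n) tvec set
     \<Rightarrow> (('m, 'n) chart \<Rightarrow> 'n \<Rightarrow> 'n \<Rightarrow> 'n fld) \<Rightarrow> bool" where
  "nonlinear_connection \<A> A N \<longleftrightarrow>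
     (\<forall>\<phi>\<in>\<A>. \<forall>k i. smooth_on (N \<phi> k i) (region \<phi> A)) \<and>
     (\<forall>\<phi>\<in>\<A>. \<forall>\<psi>\<in>\<A>. \<forall>v\<in>A. fst v \<in> fst \<phi> \<inter> fst \<psi> \<longrightarrow> (\<forall>k i.
        N \<psi> k i (tchart \<psi> v)
          = (\<Sum>c\<in>UNIV. \<Sum>b\<in>UNIV. trans_jac \<phi> \<psi> (fst v) $ k $ c
               * trans_hess \<psi> \<phi> (fst v) c i b * snd v \<psi> $ b)
            + (\<Sum>c\<in>UNIV. \<Sum>a\<in>UNIV. trans_jac \<phi> \<psi> (fst v) $ k $ c
               * trans_jac \<psi> \<phi> (fst v) $ a $ i * N \<phi> c a (tchart \<phi> v))))"

definition homogeneous_connection ::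
  "('m, 'n::finite) chart set \<Rightarrow> ('m, 'n) tvec set
     \<Rightarrow> (('m, 'n) chart \<Rightarrow> 'n \<Rightarrow> 'n \<Rightarrow> 'n fld) \<Rightarrow> bool" where
  "homogeneous_connection \<A> A N \<longleftrightarrow>
     nonlinear_connection \<A> A N \<and> (\<forall>\<phi>\<in>\<A>. \<forall>k i. pos_homogeneous 1 (region \<phi> A) (N \<phi> k i))"

definition symmetric_connection ::
  "('m, 'n::finite) chart set \<Rightarrow> ('m, 'n) tvec set
     \<Rightarrow> (('m, 'n) chart \<Rightarrow> 'n \<Rightarrow> 'n \<Rightarrow> 'n fld) \<Rightarrow> bool" where
  "symmetric_connection \<A> A N \<longleftrightarrow>
     (\<forall>\<phi>\<in>\<A>. \<forall>z\<in>region \<phi> A. \<forall>k i j. dy j (N \<phi> k i) z = dy i (N \<phi> k j) z)"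

definition affine_solution ::
  "('m, 'n::finite) chart set \<Rightarrow> ('m, 'n) tvec set \<Rightarrow> (('m, 'n) tvec \<Rightarrow> real)
     \<Rightarrow> (('m, 'n) chart \<Rightarrow> 'n \<Rightarrow> 'n \<Rightarrow> 'n fld) \<Rightarrow> bool" where
  "affine_solution \<A> A L N \<longleftrightarrow>
     homogeneous_connection \<A> A N \<and>
     (\<exists>J. aniso_endo \<A> A 1 J \<and>
        (\<forall>\<phi>\<in>\<A>. \<forall>z\<in>region \<phi> A.
           (\<forall>k i. N \<phi> k i z = conn (local_expr \<A> \<phi> L) k i z + J \<phi> k i z) \<and>
           affine_equation_at (local_expr \<A> \<phi> L) (J \<phi>) z))"

definition proper_affine_solution ::
  "('m, 'n::finite) chart set \<Rightarrow> ('m, 'n) tvec set \<Rightarrow> (('m, 'n) tvec \<Rightarrow> real)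
     \<Rightarrow> (('m, 'n) chart \<Rightarrow> 'n \<Rightarrow> 'n \<Rightarrow> 'n fld) \<Rightarrow> bool" where
  "proper_affine_solution \<A> A L N \<longleftrightarrow>
     affine_solution \<A> A L N \<and>
     (\<exists>A' N'. openin (tangent_topology \<A>) A' \<and> slit_closure \<A> A \<subseteq> A' \<and>
        A' \<subseteq> slit_tangent_bundle \<A> \<and> nonlinear_connection \<A> A' N' \<and>
        (\<forall>\<phi>\<in>\<A>. \<forall>z\<in>region \<phi> A. \<forall>k i. N' \<phi> k i z = N \<phi> k i z))"

end

theory Submission
  imports Defs
begin

text \<open>
  Everything happens in one fibre of the tangent bundle and in one chart. Let \<open>F\<close> be the
  coordinate expression of \<open>L\<close> and \<open>n\<close> the dimension. As the fibre derivatives of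
  \<open>J = \<partial>Z\<close> are symmetric, the affine equation says that the covector in braces
  vanishes (lemma \<open>affine_imp_reduced\<close>). With the Landsberg condition, all of its terms except
  the one with \<open>y\<^sub>a / L\<close> form an exact fibre differential, so that
  \<open>y\<^sub>a dy b Z\<^sup>a = 2 F dy b \<eta>\<close> with \<open>(n + 2) \<eta> = dy a Z\<^sup>a + 2 C\<^sub>a Z\<^sup>a\<close>.

  Euler's relation gives \<open>y\<^sub>a Z\<^sup>a = F \<eta>\<close>, and comparing the derivative of this with the equation
  yields \<open>Z = 2 \<eta> y - F grad \<eta>\<close> (lemma \<open>Z_eq\<close>): the whole field depends on one function of degree 1.
  Substituting back into the definition of \<open>\<eta>\<close> gives \<open>(n - 2) \<eta> = F div (grad \<eta>)\<close> (lemma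
  \<open>eta_equation\<close>), where the divergence belongs to the density \<open>|det g|\<close>. Restricted to the
  indicatrix \<open>F = 1\<close>, whose tangent spaces are negative definite for \<open>g\<close>, this is an elliptic equation
  whose zeroth order term has the sign of the maximum principle.

  The indicatrix need not be compact; properness controls its ends. There \<open>Z\<close>, hence \<open>\<eta>\<close>,
  extends smoothly across the boundary of the cone, and for \<open>n \<ge> 3\<close> the equation shows that \<open>\<eta>\<close> is
  a smooth multiple of \<open>F\<close> there. So the function \<open>\<eta>\<^sup>2 / F\<close>, of degree 0, tends to 0 at the boundary
  (lemma \<open>ratio_tendsto_zero_at_boundary\<close>). If it were positive somewhere, it would attain its
  maximum \<open>M\<close> over the fibre. At that point the Hessian of \<open>M F - \<eta>\<^sup>2\<close> would be positive semidefinite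
  with the timelike vector \<open>y\<close> in its kernel, so its trace with respect to the Lorentzian form \<open>g\<close>
  would be at most 0 (lemma \<open>lorentzian_trace_nonpos\<close>), while the equation evaluates the trace to
  \<open>2 M > 0\<close> (lemma \<open>no_interior_maximum\<close>). Hence \<open>\<eta> = 0\<close>, therefore \<open>Z = 0\<close>, and the Landsberg
  condition leaves \<open>Lan = 0\<close>.
\<close>

section \<open>Calculus of smooth functions\<close>

definition dirderiv :: "'a::real_normed_vector \<Rightarrow> ('a \<Rightarrow> real) \<Rightarrow> 'a \<Rightarrow> real" where
  "dirderiv v f x = frechet_derivative f (at x) v"

lemma dirderivI: "(f has_derivative f') (at x) \<Longrightarrow> dirderiv v f x = f' v"
  unfolding dirderiv_def using frechet_derivative_at by metis

lemma dx_eq_dirderiv: "dx i f = dirderiv (axis i 1, 0) f"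
  by (rule ext) (simp add: dx_def dirderiv_def)

lemma dy_eq_dirderiv: "dy i f = dirderiv (0, axis i 1) f"
  by (rule ext) (simp add: dy_def dirderiv_def)

lemma dirderiv_cong:
  assumes "open S" "x \<in> S" "\<And>z. z \<in> S \<Longrightarrow> f z = g z"
  shows "dirderiv v f x = dirderiv v g x"
proof (cases "f differentiable at x")
  case True
  then show ?thesis
    unfolding dirderiv_def using frechet_derivative_transform_within_open[OF True assms] by simp
next
  case False
  have "(f has_derivative D) (at x) \<longleftrightarrow> (g has_derivative D) (at x)" for D
    using assms has_derivative_transform_within_open[of f D x UNIV S g]
      has_derivative_transform_within_open[of g D x UNIV S f] by auto
  then show ?thesis
    unfolding dirderiv_def frechet_derivative_def by simp
qed

text \<open>Rewriting the recursion with \<open>dirderiv\<close> makes the product and quotient rules usable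
  in inductions on the order of differentiability.\<close>

lemma Ck_on_Suc_dirderiv:
  fixes f :: "'a::euclidean_space \<Rightarrow> real"
  shows "Ck_on (Suc k) f S \<longleftrightarrow>
    (\<forall>x\<in>S. f differentiable (at x)) \<and> (\<forall>v. Ck_on k (dirderiv v f) S)"
proof -
  have "(\<lambda>x. frechet_derivative f (at x) v) = dirderiv v f" for v
    by (rule ext) (simp add: dirderiv_def)
  then show ?thesis by simp
qed

declare Ck_on.simps(2) [simp del]

lemma Ck_on_cong:
  fixes f :: "'a::euclidean_space \<Rightarrow> real"
  assumes "open S" "\<And>z. z \<in> S \<Longrightarrow> f z = g z" "Ck_on k f S"
  shows "Ck_on k g S"
  using assms(2,3)
proof (induction k arbitrary: f g)
  case 0
  then show ?case using continuous_on_cong[of S S f g] by auto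
next
  case (Suc k)
  have "g differentiable at x" if "x \<in> S" for x
    using Suc.prems that assms(1) has_derivative_transform_within_open
    unfolding Ck_on_Suc_dirderiv differentiable_def by blast
  moreover have "Ck_on k (dirderiv v g) S" for v
    using Suc.prems
    by (intro Suc.IH[of "dirderiv v f" "dirderiv v g"] dirderiv_cong[OF assms(1)])
      (auto simp: Ck_on_Suc_dirderiv)
  ultimately show ?case by (simp add: Ck_on_Suc_dirderiv)
qed

lemma Ck_on_subset:
  fixes f :: "'a::euclidean_space \<Rightarrow> real"
  shows "Ck_on k f S \<Longrightarrow> T \<subseteq> S \<Longrightarrow> Ck_on k f T"
proof (induction k arbitrary: f)
  case 0
  then show ?case using continuous_on_subset by auto
next
  case (Suc k)
  then show ?case unfolding Ck_on_Suc_dirderiv by blast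
qed

lemma Ck_on_Suc_imp_Ck_on:
  fixes f :: "'a::euclidean_space \<Rightarrow> real"
  shows "Ck_on (Suc k) f S \<Longrightarrow> Ck_on k f S"
proof (induction k arbitrary: f)
  case 0
  then show ?case
    by (auto simp: Ck_on_Suc_dirderiv intro!: continuous_at_imp_continuous_on differentiable_imp_continuous_within)
next
  case (Suc k)
  then show ?case unfolding Ck_on_Suc_dirderiv[of "Suc k"] Ck_on_Suc_dirderiv[of k] by blast
qed

lemma has_derivative_dirderiv:
  "f differentiable (at x) \<Longrightarrow> (f has_derivative (\<lambda>v. dirderiv v f x)) (at x)"
  unfolding dirderiv_def using frechet_derivative_works by blast

lemma dirderiv_add:
  assumes "f differentiable (at x)" "g differentiable (at x)"
  shows "dirderiv v (\<lambda>x. f x + g x) x = dirderiv v f x + dirderiv v g x"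
  using assms[THEN has_derivative_dirderiv] by (intro dirderivI has_derivative_add)

lemma dirderiv_mult:
  assumes "f differentiable (at x)" "g differentiable (at x)"
  shows "dirderiv v (\<lambda>x. f x * g x) x = f x * dirderiv v g x + dirderiv v f x * g x"
  using assms[THEN has_derivative_dirderiv] by (intro dirderivI has_derivative_mult)

lemma dirderiv_inverse:
  assumes "f differentiable (at x)" "f x \<noteq> 0"
  shows "dirderiv v (\<lambda>x. inverse (f x)) x = - (inverse (f x) * dirderiv v f x * inverse (f x))"
  using assms(1)[THEN has_derivative_dirderiv] assms(2)
  by (intro dirderivI Deriv.has_derivative_inverse)

lemma dirderiv_sum:
  assumes "\<And>i. i \<in> I \<Longrightarrow> f i differentiable (at x)"
  shows "dirderiv v (\<lambda>x. \<Sum>i\<in>I. f i x) x = (\<Sum>i\<in>I. dirderiv v (f i) x)"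
  using assms[THEN has_derivative_dirderiv] by (intro dirderivI has_derivative_sum)

lemma dirderiv_const [simp]: "dirderiv v (\<lambda>x. c) x = 0"
  by (simp add: dirderiv_def)

lemma dirderiv_bounded_linear: "bounded_linear f \<Longrightarrow> dirderiv v f x = f v"
  using dirderivI[OF bounded_linear_imp_has_derivative] .

lemma Ck_on_const: "Ck_on k (\<lambda>x::'a::euclidean_space. c::real) S"
proof (induction k arbitrary: c)
  case (Suc k)
  have "dirderiv v (\<lambda>x::'a. c) = (\<lambda>x. 0)" for v by (rule ext) simp
  with Suc show ?case by (simp add: Ck_on_Suc_dirderiv)
qed simp

lemma Ck_on_add:
  fixes f g :: "'a::euclidean_space \<Rightarrow> real"
  assumes "open S"
  shows "Ck_on k f S \<Longrightarrow> Ck_on k g S \<Longrightarrow> Ck_on k (\<lambda>x. f x + g x) S"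
proof (induction k arbitrary: f g)
  case 0
  then show ?case by (auto intro: continuous_intros)
next
  case (Suc k)
  have "Ck_on k (dirderiv v (\<lambda>x. f x + g x)) S" for v
    using Suc by (intro Ck_on_cong[OF assms dirderiv_add[symmetric]] Suc.IH)
      (auto simp: Ck_on_Suc_dirderiv)
  with Suc.prems show ?case by (auto simp: Ck_on_Suc_dirderiv)
qed

lemma Ck_on_mult:
  fixes f g :: "'a::euclidean_space \<Rightarrow> real"
  assumes "open S"
  shows "Ck_on k f S \<Longrightarrow> Ck_on k g S \<Longrightarrow> Ck_on k (\<lambda>x. f x * g x) S"
proof (induction k arbitrary: f g)
  case 0
  then show ?case by (auto intro: continuous_intros)
next
  case (Suc k)
  have "Ck_on k (dirderiv v (\<lambda>x. f x * g x)) S" for v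
    using Suc Ck_on_Suc_imp_Ck_on[OF Suc.prems(1)] Ck_on_Suc_imp_Ck_on[OF Suc.prems(2)]
    by (intro Ck_on_cong[OF assms dirderiv_mult[symmetric]] Suc.IH Ck_on_add assms)
      (auto simp: Ck_on_Suc_dirderiv)
  with Suc.prems show ?case by (auto simp: Ck_on_Suc_dirderiv)
qed

lemma Ck_on_inverse:
  fixes f :: "'a::euclidean_space \<Rightarrow> real"
  assumes "open S" and nz: "\<And>x. x \<in> S \<Longrightarrow> f x \<noteq> 0"
  shows "Ck_on k f S \<Longrightarrow> Ck_on k (\<lambda>x. inverse (f x)) S"
proof (induction k)
  case 0
  then show ?case using nz by (auto intro: continuous_intros)
next
  case (Suc k)
  have IH: "Ck_on k (\<lambda>x. inverse (f x)) S"
    using Suc.IH Ck_on_Suc_imp_Ck_on[OF Suc.prems] .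
  have "Ck_on k (dirderiv v (\<lambda>x. inverse (f x))) S" for v
  proof (rule Ck_on_cong[OF assms(1)])
    show "Ck_on k (\<lambda>x. -1 * (inverse (f x) * dirderiv v f x * inverse (f x))) S"
      using Suc.prems by (intro Ck_on_mult assms(1) Ck_on_const IH) (auto simp: Ck_on_Suc_dirderiv)
  qed (use nz Suc.prems in \<open>simp add: dirderiv_inverse Ck_on_Suc_dirderiv\<close>)
  moreover have "(\<lambda>x. inverse (f x)) differentiable at x" if "x \<in> S" for x
    using Suc.prems that nz by (intro differentiable_inverse) (auto simp: Ck_on_Suc_dirderiv)
  ultimately show ?case by (auto simp: Ck_on_Suc_dirderiv)
qed

lemma Ck_on_bounded_linear:
  fixes f :: "'a::euclidean_space \<Rightarrow> real"
  assumes "bounded_linear f"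
  shows "Ck_on k f S"
proof (cases k)
  case 0
  then show ?thesis using assms by (simp add: linear_continuous_on)
next
  case (Suc l)
  have "dirderiv v f = (\<lambda>x. f v)" for v
    using dirderiv_bounded_linear[OF assms] by (intro ext) simp
  then show ?thesis
    using Suc assms by (auto simp: Ck_on_Suc_dirderiv Ck_on_const bounded_linear_imp_differentiable)
qed

lemma smooth_on_cong:
  fixes f :: "'a::euclidean_space \<Rightarrow> real"
  shows "open S \<Longrightarrow> (\<And>z. z \<in> S \<Longrightarrow> f z = g z) \<Longrightarrow> smooth_on f S \<Longrightarrow> smooth_on g S"
  unfolding smooth_on_def using Ck_on_cong by blast

lemma smooth_on_subset:
  fixes f :: "'a::euclidean_space \<Rightarrow> real"
  shows "smooth_on f S \<Longrightarrow> T \<subseteq> S \<Longrightarrow> smooth_on f T"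
  unfolding smooth_on_def using Ck_on_subset by blast

lemma smooth_on_const: "smooth_on (\<lambda>x::'a::euclidean_space. c::real) S"
  unfolding smooth_on_def by (simp add: Ck_on_const)

lemma smooth_on_bounded_linear:
  fixes f :: "'a::euclidean_space \<Rightarrow> real"
  shows "bounded_linear f \<Longrightarrow> smooth_on f S"
  unfolding smooth_on_def by (simp add: Ck_on_bounded_linear)

lemma smooth_on_add:
  fixes f g :: "'a::euclidean_space \<Rightarrow> real"
  shows "open S \<Longrightarrow> smooth_on f S \<Longrightarrow> smooth_on g S \<Longrightarrow> smooth_on (\<lambda>x. f x + g x) S"
  unfolding smooth_on_def by (simp add: Ck_on_add)

lemma smooth_on_mult:
  fixes f g :: "'a::euclidean_space \<Rightarrow> real"
  shows "open S \<Longrightarrow> smooth_on f S \<Longrightarrow> smooth_on g S \<Longrightarrow> smooth_on (\<lambda>x. f x * g x) S"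
  unfolding smooth_on_def by (simp add: Ck_on_mult)

lemma smooth_on_diff:
  fixes f g :: "'a::euclidean_space \<Rightarrow> real"
  assumes "open S" "smooth_on f S" "smooth_on g S"
  shows "smooth_on (\<lambda>x. f x - g x) S"
  using smooth_on_add[OF assms(1,2) smooth_on_mult[OF assms(1) smooth_on_const[of "-1"] assms(3)]]
  by simp

lemma smooth_on_divide:
  fixes f g :: "'a::euclidean_space \<Rightarrow> real"
  assumes "open S" "smooth_on f S" "smooth_on g S" "\<And>x. x \<in> S \<Longrightarrow> g x \<noteq> 0"
  shows "smooth_on (\<lambda>x. f x / g x) S"
proof -
  have "smooth_on (\<lambda>x. inverse (g x)) S"
    using assms unfolding smooth_on_def by (blast intro: Ck_on_inverse)
  then show ?thesis
    using smooth_on_mult[OF assms(1,2)] by (simp add: divide_inverse)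
qed

lemma smooth_on_sum:
  fixes f :: "'i \<Rightarrow> 'a::euclidean_space \<Rightarrow> real"
  assumes "open S" "\<And>i. i \<in> I \<Longrightarrow> smooth_on (f i) S"
  shows "smooth_on (\<lambda>x. \<Sum>i\<in>I. f i x) S"
  using assms(2) by (induction I rule: infinite_finite_induct)
    (auto intro: smooth_on_const smooth_on_add[OF assms(1)])

lemma smooth_on_prod:
  fixes f :: "'i \<Rightarrow> 'a::euclidean_space \<Rightarrow> real"
  assumes "open S" "\<And>i. i \<in> I \<Longrightarrow> smooth_on (f i) S"
  shows "smooth_on (\<lambda>x. \<Prod>i\<in>I. f i x) S"
  using assms(2) by (induction I rule: infinite_finite_induct)
    (auto intro: smooth_on_const smooth_on_mult[OF assms(1)])

lemma smooth_on_dirderiv: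
  fixes f :: "'a::euclidean_space \<Rightarrow> real"
  shows "smooth_on f S \<Longrightarrow> smooth_on (dirderiv v f) S"
  unfolding smooth_on_def using Ck_on_Suc_dirderiv by blast

lemma smooth_on_imp_differentiable:
  "smooth_on f S \<Longrightarrow> x \<in> S \<Longrightarrow> f differentiable (at x)"
  unfolding smooth_on_def using Ck_on.simps(2) by blast

lemma smooth_on_imp_continuous_on: "smooth_on f S \<Longrightarrow> continuous_on S f"
  unfolding smooth_on_def using Ck_on.simps(1) by blast

lemma smooth_on_det:
  fixes M :: "'a::euclidean_space \<Rightarrow> real ^ 'n ^ 'n"
  assumes "open S" "\<And>i j. smooth_on (\<lambda>x. M x $ i $ j) S"
  shows "smooth_on (\<lambda>x. det (M x)) S"
  unfolding det_def using assms
  by (intro smooth_on_sum smooth_on_mult smooth_on_const smooth_on_prod)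

lemma matrix_inv_inverse:
  fixes M :: "real ^ 'n ^ 'n"
  assumes "invertible M"
  shows "M ** matrix_inv M = mat 1" "matrix_inv M ** M = mat 1"
proof -
  have "M ** matrix_inv M = mat 1 \<and> matrix_inv M ** M = mat 1"
    unfolding matrix_inv_def by (rule someI_ex) (use assms in \<open>simp only: invertible_def\<close>)
  then show "M ** matrix_inv M = mat 1" "matrix_inv M ** M = mat 1" by (rule conjunct1, rule conjunct2)
qed

lemma matrix_inv_cramer:
  fixes M :: "real ^ 'n ^ 'n"
  assumes "invertible M"
  shows "matrix_inv M $ i $ j = det (\<chi> r c. if c = i then axis j 1 $ r else M $ r $ c) / det M"
proof -
  have "M *v column j (matrix_inv M) = column j (M ** matrix_inv M)"
    by (simp add: vec_eq_iff column_def matrix_vector_mult_def matrix_matrix_mult_def)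
  also have "M ** matrix_inv M = mat 1"
    using assms by (rule matrix_inv_inverse)
  finally have "M *v column j (matrix_inv M) = axis j 1"
    by (simp add: vec_eq_iff column_def mat_def axis_def)
  then have "column j (matrix_inv M)
      = (\<chi> k. det (\<chi> r c. if c = k then axis j 1 $ r else M $ r $ c) / det M)"
    using assms by (subst (asm) cramer) (simp_all add: invertible_det_nz)
  then show ?thesis by (simp add: vec_eq_iff column_def)
qed

text \<open>By Cramer's rule the entries of the inverse are quotients of determinants, hence rational
  functions in the entries.\<close>

lemma smooth_on_matrix_inv:
  fixes M :: "'a::euclidean_space \<Rightarrow> real ^ 'n ^ 'n"
  assumes "open S" "\<And>i j. smooth_on (\<lambda>x. M x $ i $ j) S" "\<And>x. x \<in> S \<Longrightarrow> invertible (M x)"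
  shows "smooth_on (\<lambda>x. matrix_inv (M x) $ i $ j) S"
proof (rule smooth_on_cong[OF assms(1)])
  have "smooth_on (\<lambda>x. (\<chi> r c. if c = i then axis j 1 $ r else M x $ r $ c) $ r' $ c') S" for r' c'
    using assms(2)[of r' c'] by (cases "c' = i") (auto intro: smooth_on_const)
  then show "smooth_on (\<lambda>x. det (\<chi> r c. if c = i then axis j 1 $ r else M x $ r $ c) / det (M x)) S"
    using assms by (intro smooth_on_divide smooth_on_det) (auto simp: invertible_det_nz)
qed (use assms(3) in \<open>simp add: matrix_inv_cramer\<close>)

text \<open>The mean value theorem is applied in direction \<open>u\<close> to \<open>w \<mapsto> f (w + h v) - f w\<close> and then in
  direction \<open>v\<close> to the derivative. The left-hand side is symmetric in \<open>u\<close> and \<open>v\<close>, which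
  yields the symmetry of second derivatives in the limit \<open>h \<rightarrow> 0\<close>.\<close>

lemma second_difference_mvt:
  fixes f :: "'a::euclidean_space \<Rightarrow> real"
  assumes f: "smooth_on f S" and "h > 0"
    and S: "\<And>s t. s \<in> {0..h} \<Longrightarrow> t \<in> {0..h} \<Longrightarrow> x + s *\<^sub>R u + t *\<^sub>R v \<in> S"
  shows "\<exists>s\<in>{0..h}. \<exists>t\<in>{0..h}.
    f (x + h *\<^sub>R u + h *\<^sub>R v) - f (x + h *\<^sub>R u) - f (x + h *\<^sub>R v) + f x
      = h * h * dirderiv v (dirderiv u f) (x + s *\<^sub>R u + t *\<^sub>R v)"
proof -
  have D1: "((\<lambda>s. f (x + s *\<^sub>R u + t *\<^sub>R v)) has_real_derivative dirderiv u f (x + s *\<^sub>R u + t *\<^sub>R v)) (at s)"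
    if "s \<in> {0..h}" "t \<in> {0..h}" for s t
  proof -
    have "(f has_derivative (\<lambda>w. dirderiv w f (x + s *\<^sub>R u + t *\<^sub>R v))) (at (x + s *\<^sub>R u + t *\<^sub>R v))"
      using smooth_on_imp_differentiable[OF f S[OF that]] has_derivative_dirderiv by blast
    moreover have "((\<lambda>s. x + s *\<^sub>R u + t *\<^sub>R v) has_derivative (\<lambda>r. r *\<^sub>R u)) (at s)"
      by (auto intro!: derivative_eq_intros)
    ultimately have D: "((\<lambda>s. f (x + s *\<^sub>R u + t *\<^sub>R v)) has_derivative
        (\<lambda>r. dirderiv (r *\<^sub>R u) f (x + s *\<^sub>R u + t *\<^sub>R v))) (at s)"
      by (rule has_derivative_compose[rotated])
    have "linear (\<lambda>w. dirderiv w f (x + s *\<^sub>R u + t *\<^sub>R v))"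
      using smooth_on_imp_differentiable[OF f S[OF that]] unfolding dirderiv_def
      by (rule linear_frechet_derivative)
    then have "(\<lambda>r. dirderiv (r *\<^sub>R u) f (x + s *\<^sub>R u + t *\<^sub>R v))
        = (*) (dirderiv u f (x + s *\<^sub>R u + t *\<^sub>R v))"
      by (intro ext) (drule linear_scale[of _ _ u], simp only: real_scaleR_def mult.commute)
    with D show ?thesis by (simp add: has_field_derivative_def)
  qed
  have D2: "((\<lambda>t. dirderiv u f (x + s *\<^sub>R u + t *\<^sub>R v)) has_real_derivative
      dirderiv v (dirderiv u f) (x + s *\<^sub>R u + t *\<^sub>R v)) (at t)"
    if "s \<in> {0..h}" "t \<in> {0..h}" for s t
  proof -
    have sm: "smooth_on (dirderiv u f) S" using f by (rule smooth_on_dirderiv)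
    have "(dirderiv u f has_derivative (\<lambda>w. dirderiv w (dirderiv u f) (x + s *\<^sub>R u + t *\<^sub>R v)))
        (at (x + s *\<^sub>R u + t *\<^sub>R v))"
      using smooth_on_imp_differentiable[OF sm S[OF that]] has_derivative_dirderiv by blast
    moreover have "((\<lambda>t. x + s *\<^sub>R u + t *\<^sub>R v) has_derivative (\<lambda>r. r *\<^sub>R v)) (at t)"
      by (auto intro!: derivative_eq_intros)
    ultimately have D: "((\<lambda>t. dirderiv u f (x + s *\<^sub>R u + t *\<^sub>R v)) has_derivative
        (\<lambda>r. dirderiv (r *\<^sub>R v) (dirderiv u f) (x + s *\<^sub>R u + t *\<^sub>R v))) (at t)"
      by (rule has_derivative_compose[rotated])
    have "linear (\<lambda>w. dirderiv w (dirderiv u f) (x + s *\<^sub>R u + t *\<^sub>R v))"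
      using smooth_on_imp_differentiable[OF sm S[OF that]] unfolding dirderiv_def
      by (rule linear_frechet_derivative)
    then have "(\<lambda>r. dirderiv (r *\<^sub>R v) (dirderiv u f) (x + s *\<^sub>R u + t *\<^sub>R v))
        = (*) (dirderiv v (dirderiv u f) (x + s *\<^sub>R u + t *\<^sub>R v))"
      by (intro ext) (drule linear_scale[of _ _ v], simp only: real_scaleR_def mult.commute)
    with D show ?thesis by (simp add: has_field_derivative_def)
  qed
  define g where "g s = f (x + s *\<^sub>R u + h *\<^sub>R v) - f (x + s *\<^sub>R u + 0 *\<^sub>R v)" for s
  have dg: "(g has_real_derivative
      dirderiv u f (x + s *\<^sub>R u + h *\<^sub>R v) - dirderiv u f (x + s *\<^sub>R u + 0 *\<^sub>R v)) (at s)"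
    if "s \<in> {0..h}" for s
    unfolding g_def using that \<open>h > 0\<close> by (intro DERIV_diff D1) auto
  have "\<exists>s>0. s < h \<and> g h - g 0 = (h - 0) *
      (dirderiv u f (x + s *\<^sub>R u + h *\<^sub>R v) - dirderiv u f (x + s *\<^sub>R u + 0 *\<^sub>R v))"
    by (rule MVT2[OF \<open>h > 0\<close>]) (rule dg, simp)
  then obtain s where s: "0 < s" "s < h"
    and gs: "g h - g 0 = (h - 0) *
      (dirderiv u f (x + s *\<^sub>R u + h *\<^sub>R v) - dirderiv u f (x + s *\<^sub>R u + 0 *\<^sub>R v))"
    by blast
  have "\<exists>t>0. t < h \<and>
      dirderiv u f (x + s *\<^sub>R u + h *\<^sub>R v) - dirderiv u f (x + s *\<^sub>R u + 0 *\<^sub>R v)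
      = (h - 0) * dirderiv v (dirderiv u f) (x + s *\<^sub>R u + t *\<^sub>R v)"
    by (rule MVT2[OF \<open>h > 0\<close>]) (rule D2, use s in auto)
  then obtain t where t: "0 < t" "t < h"
    and "dirderiv u f (x + s *\<^sub>R u + h *\<^sub>R v) - dirderiv u f (x + s *\<^sub>R u + 0 *\<^sub>R v)
      = (h - 0) * dirderiv v (dirderiv u f) (x + s *\<^sub>R u + t *\<^sub>R v)"
    by blast
  with gs have "g h - g 0 = h * h * dirderiv v (dirderiv u f) (x + s *\<^sub>R u + t *\<^sub>R v)" by simp
  moreover have "g h - g 0 = f (x + h *\<^sub>R u + h *\<^sub>R v) - f (x + h *\<^sub>R u) - f (x + h *\<^sub>R v) + f x"
    by (simp add: g_def)
  ultimately show ?thesis using s t by (intro bexI[of _ s] bexI[of _ t]) auto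
qed

lemma dirderiv_commute:
  fixes f :: "'a::euclidean_space \<Rightarrow> real"
  assumes f: "smooth_on f S" and "open S" "x \<in> S"
  shows "dirderiv v (dirderiv u f) x = dirderiv u (dirderiv v f) x"
proof (rule ccontr)
  let ?a = "dirderiv v (dirderiv u f)" and ?b = "dirderiv u (dirderiv v f)"
  define e where "e = \<bar>?a x - ?b x\<bar> / 2"
  assume "?a x \<noteq> ?b x"
  then have "e > 0" by (simp add: e_def)
  have cont: "continuous_on S ?a" "continuous_on S ?b"
    using f by (auto intro: smooth_on_imp_continuous_on smooth_on_dirderiv)
  obtain r0 where r0: "r0 > 0" "ball x r0 \<subseteq> S" using assms(2,3) openE by blast
  obtain r1 where r1: "r1 > 0" "\<And>z. z \<in> S \<Longrightarrow> dist z x < r1 \<Longrightarrow> dist (?a z) (?a x) < e"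
    using cont(1) \<open>x \<in> S\<close> \<open>e > 0\<close> unfolding continuous_on_iff by meson
  obtain r2 where r2: "r2 > 0" "\<And>z. z \<in> S \<Longrightarrow> dist z x < r2 \<Longrightarrow> dist (?b z) (?b x) < e"
    using cont(2) \<open>x \<in> S\<close> \<open>e > 0\<close> unfolding continuous_on_iff by meson
  define r where "r = min r0 (min r1 r2)"
  have "r > 0" using r0 r1 r2 by (simp add: r_def)
  define h where "h = r / (2 * (norm u + norm v + 1))"
  have "h > 0" using \<open>r > 0\<close> by (simp add: h_def add_nonneg_pos)
  have hr: "h * (norm u + norm v) < r"
  proof -
    have "h * (norm u + norm v) \<le> h * (norm u + norm v + 1)" using \<open>h > 0\<close> by simp
    also have "\<dots> = r / 2"
      by (simp add: h_def field_simps add_nonneg_eq_0_iff)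
    also have "\<dots> < r" using \<open>r > 0\<close> by simp
    finally show ?thesis .
  qed
  have near: "dist (x + s *\<^sub>R u + t *\<^sub>R v) x < r" if "s \<in> {0..h}" "t \<in> {0..h}" for s t
  proof -
    have "dist (x + s *\<^sub>R u + t *\<^sub>R v) x = norm (s *\<^sub>R u + t *\<^sub>R v)"
      by (simp add: dist_norm algebra_simps)
    also have "\<dots> \<le> s * norm u + t * norm v"
      using that norm_triangle_ineq[of "s *\<^sub>R u" "t *\<^sub>R v"] by simp
    also have "\<dots> \<le> h * norm u + h * norm v"
      using that by (intro add_mono mult_right_mono) auto
    finally show ?thesis using hr by (simp add: distrib_left)
  qed
  have inS: "x + s *\<^sub>R u + t *\<^sub>R v \<in> S" if "s \<in> {0..h}" "t \<in> {0..h}" for s t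
    using near[OF that] r0 by (auto simp: r_def dist_commute)
  obtain s t where st: "s \<in> {0..h}" "t \<in> {0..h}"
    "f (x + h *\<^sub>R u + h *\<^sub>R v) - f (x + h *\<^sub>R u) - f (x + h *\<^sub>R v) + f x
      = h * h * ?a (x + s *\<^sub>R u + t *\<^sub>R v)"
    using second_difference_mvt[OF f \<open>h > 0\<close> inS] by blast
  have inS': "x + t *\<^sub>R v + s *\<^sub>R u \<in> S" if "t \<in> {0..h}" "s \<in> {0..h}" for s t
    using inS[OF that(2,1)] by (simp add: algebra_simps)
  obtain s' t' where st': "s' \<in> {0..h}" "t' \<in> {0..h}"
    "f (x + h *\<^sub>R v + h *\<^sub>R u) - f (x + h *\<^sub>R v) - f (x + h *\<^sub>R u) + f x
      = h * h * ?b (x + t' *\<^sub>R v + s' *\<^sub>R u)"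
    using second_difference_mvt[OF f \<open>h > 0\<close> inS'] by blast
  have "h * h * ?a (x + s *\<^sub>R u + t *\<^sub>R v) = h * h * ?b (x + s' *\<^sub>R u + t' *\<^sub>R v)"
    using st(3) st'(3) by (simp add: algebra_simps)
  then have "?a (x + s *\<^sub>R u + t *\<^sub>R v) = ?b (x + s' *\<^sub>R u + t' *\<^sub>R v)"
    using \<open>h > 0\<close> by simp
  moreover have "dist (?a (x + s *\<^sub>R u + t *\<^sub>R v)) (?a x) < e"
    using r1 inS[OF st(1,2)] near[OF st(1,2)] by (simp add: r_def)
  moreover have "dist (?b (x + s' *\<^sub>R u + t' *\<^sub>R v)) (?b x) < e"
    using r2 inS[OF st'(1,2)] near[OF st'(1,2)] by (simp add: r_def)
  moreover have "\<bar>?a x - ?b x\<bar> = 2 * e" by (simp add: e_def)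
  ultimately show False unfolding dist_real_def by linarith
qed

section \<open>Fibre derivatives and homogeneity\<close>

lemma dy_add:
  "f differentiable (at z) \<Longrightarrow> g differentiable (at z) \<Longrightarrow>
    dy i (\<lambda>z. f z + g z) z = dy i f z + dy i g z"
  unfolding dy_eq_dirderiv by (rule dirderiv_add)

lemma dy_mult:
  "f differentiable (at z) \<Longrightarrow> g differentiable (at z) \<Longrightarrow>
    dy i (\<lambda>z. f z * g z) z = f z * dy i g z + dy i f z * g z"
  unfolding dy_eq_dirderiv by (rule dirderiv_mult)

lemma dy_cmult:
  "f differentiable (at z) \<Longrightarrow> dy i (\<lambda>z. c * f z) z = c * dy i f z"
  unfolding dy_eq_dirderiv by (subst dirderiv_mult) auto

lemma dy_diff:
  assumes "f differentiable (at z)" "g differentiable (at z)"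
  shows "dy i (\<lambda>z. f z - g z) z = dy i f z - dy i g z"
  using dy_add[OF assms(1) differentiable_mult[OF differentiable_const assms(2)], of i "-1"]
    dy_cmult[OF assms(2), of i "-1"] by simp

lemma dy_sum:
  "(\<And>k. k \<in> I \<Longrightarrow> f k differentiable (at z)) \<Longrightarrow>
    dy i (\<lambda>z. \<Sum>k\<in>I. f k z) z = (\<Sum>k\<in>I. dy i (f k) z)"
  unfolding dy_eq_dirderiv by (rule dirderiv_sum)

lemma dy_const [simp]: "dy i (\<lambda>z. c) z = 0"
  unfolding dy_eq_dirderiv by simp

lemma dy_cong:
  "open S \<Longrightarrow> z \<in> S \<Longrightarrow> (\<And>w. w \<in> S \<Longrightarrow> f w = g w) \<Longrightarrow> dy i f z = dy i g z"
  unfolding dy_eq_dirderiv by (rule dirderiv_cong)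

lemma dx_cong:
  "open S \<Longrightarrow> z \<in> S \<Longrightarrow> (\<And>w. w \<in> S \<Longrightarrow> f w = g w) \<Longrightarrow> dx i f z = dx i g z"
  unfolding dx_eq_dirderiv by (rule dirderiv_cong)

lemma bounded_linear_fibre_coordinate: "bounded_linear (\<lambda>z::(real^'n::finite) \<times> (real^'n). snd z $ j)"
  by (intro bounded_linear_compose[OF bounded_linear_vec_nth bounded_linear_snd])

lemma dy_fibre_coordinate: "dy i (\<lambda>z. snd z $ j) z = kdelta i j"
  unfolding dy_eq_dirderiv dirderiv_bounded_linear[OF bounded_linear_fibre_coordinate]
  by (simp add: axis_def kdelta_def)

lemma smooth_on_fibre_coordinate:
  "smooth_on (\<lambda>z::(real^'n::finite) \<times> (real^'n). snd z $ j) S"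
  by (rule smooth_on_bounded_linear[OF bounded_linear_fibre_coordinate])

lemma smooth_on_dy: "smooth_on f S \<Longrightarrow> smooth_on (dy i f) S"
  unfolding dy_eq_dirderiv by (rule smooth_on_dirderiv)

lemma smooth_on_dx: "smooth_on f S \<Longrightarrow> smooth_on (dx i f) S"
  unfolding dx_eq_dirderiv by (rule smooth_on_dirderiv)

lemma dy_commute: "smooth_on f S \<Longrightarrow> open S \<Longrightarrow> z \<in> S \<Longrightarrow> dy i (dy j f) z = dy j (dy i f) z"
  unfolding dy_eq_dirderiv by (rule dirderiv_commute)

lemmas smooth_intros = smooth_on_const smooth_on_fibre_coordinate smooth_on_dy smooth_on_dx
  smooth_on_sum smooth_on_add smooth_on_diff smooth_on_mult

lemma dirderiv_vertical:
  fixes f :: "'n::finite fld"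
  assumes "f differentiable (at z)"
  shows "dirderiv (0, w) f z = (\<Sum>i\<in>UNIV. w $ i * dy i f z)"
proof -
  have lin: "linear (\<lambda>v. dirderiv v f z)"
    using linear_frechet_derivative[OF assms] by (simp add: dirderiv_def)
  have "(\<Sum>i\<in>UNIV. w $ i *\<^sub>R (0::real^'n, axis i (1::real))) = (0, \<Sum>i\<in>UNIV. w $ i *\<^sub>R axis i 1)"
    by (simp add: prod_eq_iff fst_sum snd_sum)
  also have "(\<Sum>i\<in>UNIV. w $ i *\<^sub>R axis i (1::real)) = w"
    using basis_expansion[of w] by (simp add: scalar_mult_eq_scaleR)
  finally have "dirderiv (0, w) f z = dirderiv (\<Sum>i\<in>UNIV. w $ i *\<^sub>R (0, axis i 1)) f z" by simp
  also have "\<dots> = (\<Sum>i\<in>UNIV. dirderiv (w $ i *\<^sub>R (0, axis i 1)) f z)"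
    using linear_sum[OF lin] .
  also have "\<dots> = (\<Sum>i\<in>UNIV. w $ i * dy i f z)"
    using linear_scale[OF lin] by (simp add: dy_eq_dirderiv del: scaleR_Pair)
  finally show ?thesis .
qed

definition conic :: "((real ^ 'n) \<times> (real ^ 'n)) set \<Rightarrow> bool" where
  "conic R \<longleftrightarrow> (\<forall>x y t. (x, y) \<in> R \<longrightarrow> t > 0 \<longrightarrow> (x, t *\<^sub>R y) \<in> R)"

text \<open>Degrees are integers because the mean Cartan tensor has degree \<open>-1\<close>.\<close>

definition homogeneous :: "int \<Rightarrow> ((real ^ 'n) \<times> (real ^ 'n)) set \<Rightarrow> 'n::finite fld \<Rightarrow> bool" where
  "homogeneous d R f \<longleftrightarrow> (\<forall>x y t. (x, y) \<in> R \<longrightarrow> t > 0 \<longrightarrow> f (x, t *\<^sub>R y) = t powi d * f (x, y))"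

lemma homogeneousD:
  "homogeneous d R f \<Longrightarrow> (x, y) \<in> R \<Longrightarrow> t > 0 \<Longrightarrow> f (x, t *\<^sub>R y) = t powi d * f (x, y)"
  unfolding homogeneous_def by blast

lemma pos_homogeneous_imp_homogeneous:
  "pos_homogeneous n R f \<Longrightarrow> homogeneous (int n) R f"
  unfolding pos_homogeneous_def homogeneous_def by auto

lemma homogeneous_add:
  "homogeneous d R f \<Longrightarrow> homogeneous d R g \<Longrightarrow> homogeneous d R (\<lambda>z. f z + g z)"
  unfolding homogeneous_def by (simp add: distrib_left)

lemma homogeneous_cmult: "homogeneous d R f \<Longrightarrow> homogeneous d R (\<lambda>z. c * f z)"
  unfolding homogeneous_def by simp

lemma homogeneous_sum:
  "(\<And>i. i \<in> I \<Longrightarrow> homogeneous d R (f i)) \<Longrightarrow> homogeneous d R (\<lambda>z. \<Sum>i\<in>I. f i z)"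
  unfolding homogeneous_def by (auto simp: sum_distrib_left intro!: sum.cong)

lemma homogeneous_mult:
  assumes "homogeneous d R f" "homogeneous e R g" "k = d + e"
  shows "homogeneous k R (\<lambda>z. f z * g z)"
  using assms unfolding homogeneous_def by (simp add: power_int_add)

text \<open>Differentiate \<open>f (x, t y) = t\<^sup>d f (x, y)\<close> with respect to \<open>y\<close>.\<close>

lemma homogeneous_dy:
  assumes R: "open R" "conic R" and f: "smooth_on f R" "homogeneous d R f" and e: "e = d - 1"
  shows "homogeneous e R (dy i f)"
  unfolding homogeneous_def
proof (intro allI impI)
  fix x y and t :: real
  assume z: "(x, y) \<in> R" and t: "t > 0"
  define s where "s z = (fst z, t *\<^sub>R snd z)" for z :: "(real ^ 'a) \<times> (real ^ 'a)"
  have tz: "(x, t *\<^sub>R y) \<in> R" using R z t by (auto simp: conic_def)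
  have df: "f differentiable (at (x, t *\<^sub>R y))" and df': "f differentiable (at (x, y))"
    using smooth_on_imp_differentiable[OF f(1)] z tz by blast+
  have "(s has_derivative s) (at (x, y))"
    unfolding s_def by (auto intro!: derivative_eq_intros)
  moreover have "(f has_derivative (\<lambda>v. dirderiv v f (x, t *\<^sub>R y))) (at (s (x, y)))"
    using has_derivative_dirderiv[OF df] by (simp add: s_def)
  ultimately have "((\<lambda>z. f (s z)) has_derivative (\<lambda>v. dirderiv (s v) f (x, t *\<^sub>R y))) (at (x, y))"
    by (rule has_derivative_compose)
  from dirderivI[OF this, of "(0, axis i 1)"]
  have "dy i (\<lambda>z. f (s z)) (x, y) = dirderiv (0, t *\<^sub>R axis i 1) f (x, t *\<^sub>R y)"
    by (simp add: s_def dy_eq_dirderiv)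
  also have "\<dots> = t * dy i f (x, t *\<^sub>R y)"
  proof -
    have "dirderiv (t *\<^sub>R (0, axis i 1)) f (x, t *\<^sub>R y) = t *\<^sub>R dirderiv (0, axis i 1) f (x, t *\<^sub>R y)"
      unfolding dirderiv_def by (rule linear_scale[OF linear_frechet_derivative[OF df]])
    then show ?thesis by (simp add: dy_eq_dirderiv)
  qed
  finally have 1: "dy i (\<lambda>z. f (s z)) (x, y) = t * dy i f (x, t *\<^sub>R y)" .
  have "dy i (\<lambda>z. f (s z)) (x, y) = dy i (\<lambda>z. t powi d * f z) (x, y)"
    using f(2) t by (intro dy_cong[OF R(1) z]) (auto simp: s_def homogeneous_def)
  also have "\<dots> = t powi d * dy i f (x, y)"
    using df' by (rule dy_cmult)
  finally have "t * dy i f (x, t *\<^sub>R y) = t powi d * dy i f (x, y)" using 1 by simp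
  then show "dy i f (x, t *\<^sub>R y) = t powi e * dy i f (x, y)"
    unfolding e using t by (simp add: power_int_diff field_simps)
qed

text \<open>Euler's relation: differentiate \<open>f (x, t y) = t\<^sup>d f (x, y)\<close> with respect to \<open>t\<close> at \<open>t = 1\<close>.\<close>

lemma euler_homogeneous:
  assumes R: "open R" and f: "smooth_on f R" "homogeneous d R f" and z: "z \<in> R"
  shows "(\<Sum>i\<in>UNIV. dy i f z * snd z $ i) = of_int d * f z"
proof -
  obtain x y where xy: "z = (x, y)" by (cases z)
  have df: "f differentiable (at (x, y))"
    using smooth_on_imp_differentiable[OF f(1)] z xy by blast
  have "((\<lambda>t. (x, t *\<^sub>R y)) has_derivative (\<lambda>r. (0, r *\<^sub>R y))) (at 1)"
    by (auto intro!: derivative_eq_intros)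
  moreover have "(f has_derivative (\<lambda>v. dirderiv v f (x, y))) (at ((\<lambda>t. (x, t *\<^sub>R y)) 1))"
    using has_derivative_dirderiv[OF df] by simp
  ultimately have "((\<lambda>t. f (x, t *\<^sub>R y)) has_derivative (\<lambda>r. dirderiv (0, r *\<^sub>R y) f (x, y))) (at 1)"
    by (rule has_derivative_compose)
  moreover have "(\<lambda>r. dirderiv (0, r *\<^sub>R y) f (x, y)) = (*) (\<Sum>i\<in>UNIV. dy i f z * snd z $ i)"
    by (rule ext) (simp add: dirderiv_vertical[OF df] xy sum_distrib_left mult_ac)
  ultimately have 1: "((\<lambda>t. f (x, t *\<^sub>R y)) has_real_derivative
      (\<Sum>i\<in>UNIV. dy i f z * snd z $ i)) (at 1)"
    by (simp add: has_field_derivative_def)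
  have "((\<lambda>t. t powi d * f z) has_real_derivative of_int d * f z) (at 1)"
    by (auto intro!: derivative_eq_intros)
  then have "((\<lambda>t. f (x, t *\<^sub>R y)) has_real_derivative of_int d * f z) (at 1)"
    by (rule has_field_derivative_transform_within_open[of _ _ _ "{0<..}"])
       (use f(2) z xy in \<open>auto simp: homogeneous_def\<close>)
  with 1 show ?thesis by (rule DERIV_unique)
qed

lemma second_derivative_at_minimum:
  fixes q :: "'a::euclidean_space \<Rightarrow> real"
  assumes "open R" "smooth_on q R" "z \<in> R"
    and min: "\<And>t. z + t *\<^sub>R w \<in> R \<Longrightarrow> q z \<le> q (z + t *\<^sub>R w)"
  shows "dirderiv w q z = 0" "dirderiv w (dirderiv w q) z \<ge> 0"
proof -
  have D: "((\<lambda>t. f (z + t *\<^sub>R w)) has_real_derivative dirderiv w f (z + t *\<^sub>R w)) (at t)"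
    if "smooth_on f R" "z + t *\<^sub>R w \<in> R" for f t
  proof -
    have df: "f differentiable (at (z + t *\<^sub>R w))"
      using smooth_on_imp_differentiable that by blast
    have "((\<lambda>t. z + t *\<^sub>R w) has_derivative (\<lambda>r. r *\<^sub>R w)) (at t)"
      by (auto intro!: derivative_eq_intros)
    from has_derivative_compose[OF this has_derivative_dirderiv[OF df]]
    have "((\<lambda>t. f (z + t *\<^sub>R w)) has_derivative (\<lambda>r. dirderiv (r *\<^sub>R w) f (z + t *\<^sub>R w))) (at t)" .
    moreover have "dirderiv (r *\<^sub>R w) f (z + t *\<^sub>R w) = r *\<^sub>R dirderiv w f (z + t *\<^sub>R w)" for r
      unfolding dirderiv_def by (rule linear_scale[OF linear_frechet_derivative[OF df]])
    ultimately show ?thesis by (simp add: has_field_derivative_def mult_commute_abs)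
  qed
  have "continuous_on UNIV (\<lambda>t. z + t *\<^sub>R w)" by (intro continuous_intros)
  then have "open ((\<lambda>t. z + t *\<^sub>R w) -` R)" using \<open>open R\<close> by (rule open_vimage[rotated])
  moreover have "0 \<in> (\<lambda>t. z + t *\<^sub>R w) -` R" using \<open>z \<in> R\<close> by simp
  ultimately obtain d where d: "d > 0" "ball 0 d \<subseteq> (\<lambda>t. z + t *\<^sub>R w) -` R"
    using openE by blast
  have inR: "z + t *\<^sub>R w \<in> R" if "\<bar>t\<bar> < d" for t using d(2) that by auto
  have D0: "((\<lambda>t. q (z + t *\<^sub>R w)) has_real_derivative dirderiv w q z) (at 0)"
    using D[OF assms(2), of 0] \<open>z \<in> R\<close> by simp
  show first: "dirderiv w q z = 0"
    by (rule DERIV_local_min[OF D0 d(1)]) (use min inR in auto)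
  show "dirderiv w (dirderiv w q) z \<ge> 0"
  proof (rule ccontr)
    assume neg: "\<not> ?thesis"
    have "((\<lambda>t. dirderiv w q (z + t *\<^sub>R w)) has_real_derivative dirderiv w (dirderiv w q) z) (at 0)"
      using D[OF smooth_on_dirderiv[OF assms(2)], of 0] \<open>z \<in> R\<close> by simp
    from DERIV_neg_dec_right[OF this] neg obtain e where e: "e > 0"
      "\<And>h. 0 < h \<Longrightarrow> h < e \<Longrightarrow> dirderiv w q (z + h *\<^sub>R w) < 0"
      using first by auto
    define h where "h = min d e / 2"
    have h: "0 < h" "h < d" "h < e" using d(1) e(1) by (auto simp: h_def)
    have "\<exists>\<xi>>0. \<xi> < h \<and> q (z + h *\<^sub>R w) - q (z + 0 *\<^sub>R w) = (h - 0) * dirderiv w q (z + \<xi> *\<^sub>R w)"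
      by (rule MVT2[OF h(1), of "\<lambda>t. q (z + t *\<^sub>R w)"]) (use h inR in \<open>auto intro!: D assms(2)\<close>)
    then obtain \<xi> where "0 < \<xi>" "\<xi> < h" "q (z + h *\<^sub>R w) - q z = h * dirderiv w q (z + \<xi> *\<^sub>R w)"
      by auto
    moreover have "h * dirderiv w q (z + \<xi> *\<^sub>R w) < 0"
      using e(2)[of \<xi>] \<open>0 < \<xi>\<close> \<open>\<xi> < h\<close> h by (intro mult_pos_neg) auto
    moreover have "q z \<le> q (z + h *\<^sub>R w)" using min inR[of h] h by auto
    ultimately show False by linarith
  qed
qed

section \<open>A trace inequality for Lorentzian forms\<close>

text \<open>Write \<open>c = c\<^sub>k e\<^sub>k + r\<close>. As \<open>c\<close> is in the kernel, \<open>c\<^sub>k\<^sup>2 Q\<^sub>k\<^sub>k = Q(r, r)\<close>; semidefiniteness bounds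
  this by \<open>|r|\<^sup>2\<close> times the trace of \<open>Q\<close> on the complement of \<open>e\<^sub>k\<close>, and \<open>|r|\<^sup>2 < c\<^sub>k\<^sup>2\<close>.\<close>

lemma psd_timelike_kernel_diagonal:
  fixes Q :: "real ^ 'n ^ 'n" and c :: "real ^ 'n"
  assumes sym: "transpose Q = Q" and psd: "\<And>w. w \<bullet> (Q *v w) \<ge> 0" and ker: "Q *v c = 0"
    and timelike: "(\<Sum>i\<in>UNIV - {k}. (c $ i)\<^sup>2) < (c $ k)\<^sup>2"
  shows "Q $ k $ k \<le> (\<Sum>i\<in>UNIV - {k}. Q $ i $ i)"
proof -
  let ?I = "UNIV - {k}"
  define r where "r = c - c $ k *\<^sub>R axis k 1"
  define T where "T = (\<Sum>i\<in>?I. Q $ i $ i)"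
  have r: "r $ i = (if i = k then 0 else c $ i)" for i by (simp add: r_def axis_def)
  have quad: "v \<bullet> (Q *v w) = (\<Sum>i\<in>UNIV. \<Sum>j\<in>UNIV. v $ i * w $ j * Q $ i $ j)" for v w
    by (simp add: inner_vec_def matrix_vector_mult_def sum_distrib_left mult_ac)
  have swap: "v \<bullet> (Q *v w) = w \<bullet> (Q *v v)" for v w
    by (metis dot_lmul_matrix inner_commute sym transpose_matrix_vector)
  have symij: "Q $ i $ j = Q $ j $ i" for i j
    using sym by (metis transpose_def vec_lambda_beta)
  have axq: "axis i 1 \<bullet> (Q *v axis j 1) = Q $ i $ j" for i j
    by (simp add: inner_axis' matrix_vector_mult_basis column_def)
  have diag: "Q $ i $ i \<ge> 0" for i using psd[of "axis i 1"] by (simp add: axq)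
  \<comment> \<open>Semidefiniteness on the plane of \<open>e\<^sub>i\<close> and \<open>e\<^sub>j\<close>, tested on \<open>r\<^sub>j e\<^sub>i - r\<^sub>i e\<^sub>j\<close>.\<close>
  have pair: "2 * (r $ i * r $ j * Q $ i $ j) \<le> (r $ j)\<^sup>2 * Q $ i $ i + (r $ i)\<^sup>2 * Q $ j $ j" for i j
  proof -
    have "0 \<le> (r $ j *\<^sub>R axis i 1 - r $ i *\<^sub>R axis j 1) \<bullet> (Q *v (r $ j *\<^sub>R axis i 1 - r $ i *\<^sub>R axis j 1))"
      by (rule psd)
    also have "\<dots> = (r $ j)\<^sup>2 * Q $ i $ i + (r $ i)\<^sup>2 * Q $ j $ j - 2 * (r $ i * r $ j * Q $ i $ j)"
      using symij[of i j]
      by (simp add: matrix_vector_mult_diff_distrib matrix_vector_mult_scaleR inner_diff_left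
        inner_diff_right axq power2_eq_square algebra_simps)
    finally show ?thesis by simp
  qed
  have "(c $ k)\<^sup>2 * Q $ k $ k = (c - r) \<bullet> (Q *v (c - r))"
    by (simp add: r_def matrix_vector_mult_scaleR axq power2_eq_square)
  also have "\<dots> = r \<bullet> (Q *v r)"
    using ker swap[of c r]
    by (simp add: matrix_vector_mult_diff_distrib inner_diff_left inner_diff_right)
  also have "\<dots> = (\<Sum>i\<in>?I. \<Sum>j\<in>?I. r $ i * r $ j * Q $ i $ j)"
    unfolding quad by (intro sum.mono_neutral_cong_right sum.mono_neutral_right) (auto simp: r)
  finally have eq: "(c $ k)\<^sup>2 * Q $ k $ k = (\<Sum>i\<in>?I. \<Sum>j\<in>?I. r $ i * r $ j * Q $ i $ j)" .
  have "2 * (\<Sum>i\<in>?I. \<Sum>j\<in>?I. r $ i * r $ j * Q $ i $ j)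
      \<le> (\<Sum>i\<in>?I. \<Sum>j\<in>?I. (r $ j)\<^sup>2 * Q $ i $ i + (r $ i)\<^sup>2 * Q $ j $ j)"
    unfolding sum_distrib_left by (intro sum_mono pair)
  also have "\<dots> = 2 * ((\<Sum>i\<in>?I. (r $ i)\<^sup>2) * T)"
  proof -
    have "(\<Sum>i\<in>?I. \<Sum>j\<in>?I. (r $ i)\<^sup>2 * Q $ j $ j) = (\<Sum>i\<in>?I. (r $ i)\<^sup>2) * T"
      by (simp add: sum_product T_def)
    moreover from this have "(\<Sum>i\<in>?I. \<Sum>j\<in>?I. (r $ j)\<^sup>2 * Q $ i $ i) = (\<Sum>i\<in>?I. (r $ i)\<^sup>2) * T"
      by (subst sum.swap)
    ultimately show ?thesis by (simp add: sum.distrib)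
  qed
  also have "(\<Sum>i\<in>?I. (r $ i)\<^sup>2) = (\<Sum>i\<in>?I. (c $ i)\<^sup>2)" by (simp add: r)
  finally have "(c $ k)\<^sup>2 * Q $ k $ k \<le> (\<Sum>i\<in>?I. (c $ i)\<^sup>2) * T" using eq by simp
  also have "\<dots> \<le> (c $ k)\<^sup>2 * T"
    using timelike diag by (intro mult_right_mono) (auto simp: T_def intro: sum_nonneg)
  finally have "(c $ k)\<^sup>2 * Q $ k $ k \<le> (c $ k)\<^sup>2 * T" .
  moreover have "(c $ k)\<^sup>2 > 0"
    using timelike sum_nonneg[of ?I "\<lambda>i. (c $ i)\<^sup>2"] by fastforce
  ultimately show ?thesis by (simp add: T_def)
qed

text \<open>A form that annihilates the timelike vector \<open>y\<close> is determined by its restriction to the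
  orthogonal complement of \<open>y\<close>, where the Lorentzian form is negative definite. The proof passes to a
  \<open>G\<close>-orthonormal basis, the columns of \<open>P\<close>. This is what makes a differential operator with
  principal part \<open>g\<close> behave elliptically on homogeneous functions.\<close>

lemma lorentzian_trace_nonpos:
  fixes G Q :: "real ^ 'n ^ 'n::finite" and y :: "real ^ 'n"
  assumes "lorentzian G" and timelike: "y \<bullet> (G *v y) > 0"
    and sym: "transpose Q = Q" and psd: "\<And>w. w \<bullet> (Q *v w) \<ge> 0" and ker: "Q *v y = 0"
  shows "(\<Sum>a\<in>UNIV. \<Sum>b\<in>UNIV. matrix_inv G $ a $ b * Q $ a $ b) \<le> 0"
proof -
  obtain P :: "real ^ 'n ^ 'n" and k where P: "invertible P"
    and D: "transpose P ** G ** P = (\<chi> i j. if i = j then (if i = k then 1 else -1) else 0)"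
    using assms(1) unfolding lorentzian_def by blast
  define \<epsilon> where "\<epsilon> i = (if i = k then 1 else -1 :: real)" for i
  define E where "E = (\<chi> i j. if i = j then \<epsilon> i else 0)"
  have PGP: "transpose P ** G ** P = E" unfolding D E_def \<epsilon>_def by (simp add: vec_eq_iff)
  have "\<epsilon> i * \<epsilon> i = 1" for i by (simp add: \<epsilon>_def)
  then have EE: "E ** E = mat 1"
    by (auto simp: E_def matrix_matrix_mult_def mat_def vec_eq_iff if_distrib cong: if_cong
      intro!: sum.neutral)
  have Pt: "transpose P ** transpose (matrix_inv P) = mat 1" "transpose (matrix_inv P) ** transpose P = mat 1"
    using matrix_inv_inverse[OF P] by (metis matrix_transpose_mul transpose_mat)+
  have "transpose P ** (G ** (P ** E ** transpose P)) = transpose P"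
  proof -
    have "transpose P ** (G ** (P ** E ** transpose P)) = (transpose P ** G ** P) ** E ** transpose P"
      by (simp add: matrix_mul_assoc)
    then show ?thesis by (simp add: PGP EE)
  qed
  then have "transpose (matrix_inv P) ** (transpose P ** (G ** (P ** E ** transpose P))) = mat 1"
    using Pt by simp
  then have right: "G ** (P ** E ** transpose P) = mat 1"
    using Pt by (simp add: matrix_mul_assoc)
  then have "invertible G" using invertible_right_inverse by blast
  then have Ginv: "matrix_inv G = P ** E ** transpose P"
    using right by (metis matrix_inv_inverse(2) matrix_mul_assoc matrix_mul_lid matrix_mul_rid)
  define c where "c = matrix_inv P *v y"
  have y: "y = P *v c"
    using matrix_inv_inverse(1)[OF P] by (simp add: c_def matrix_vector_mul_assoc)
  define Q' where "Q' = transpose P ** Q ** P"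
  have form: "(P *v v) \<bullet> (M *v (P *v w)) = v \<bullet> ((transpose P ** M ** P) *v w)" for M v w
    by (simp add: dot_lmul_matrix[symmetric] matrix_vector_mul_assoc[symmetric] inner_commute)
       (metis dot_lmul_matrix transpose_matrix_vector transpose_transpose inner_commute)
  have "Q' $ k $ k \<le> (\<Sum>i\<in>UNIV - {k}. Q' $ i $ i)"
  proof (rule psd_timelike_kernel_diagonal)
    show "transpose Q' = Q'"
      using sym by (simp add: Q'_def matrix_transpose_mul matrix_mul_assoc)
    show "w \<bullet> (Q' *v w) \<ge> 0" for w
      using psd[of "P *v w"] by (simp add: form Q'_def)
    show "Q' *v c = 0"
      using ker by (simp add: Q'_def y matrix_vector_mul_assoc[symmetric] del: matrix_vector_mul_assoc)
    have "0 < c \<bullet> (E *v c)"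
      using timelike unfolding y form PGP .
    also have "c \<bullet> (E *v c) = (\<Sum>i\<in>UNIV. \<epsilon> i * (c $ i)\<^sup>2)"
      by (simp add: E_def inner_vec_def matrix_vector_mult_def power2_eq_square
        if_distrib[of "\<lambda>x. _ * x"] mult_ac cong: if_cong)
    also have "\<dots> = (c $ k)\<^sup>2 - (\<Sum>i\<in>UNIV - {k}. (c $ i)\<^sup>2)"
      by (subst sum.remove[of _ k]) (auto simp: \<epsilon>_def sum_negf[symmetric] intro!: sum.cong)
    finally show "(\<Sum>i\<in>UNIV - {k}. (c $ i)\<^sup>2) < (c $ k)\<^sup>2" by simp
  qed
  moreover have "(\<Sum>a\<in>UNIV. \<Sum>b\<in>UNIV. matrix_inv G $ a $ b * Q $ a $ b) = (\<Sum>i\<in>UNIV. \<epsilon> i * Q' $ i $ i)"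
  proof -
    have "matrix_inv G $ a $ b = (\<Sum>i\<in>UNIV. P $ a $ i * \<epsilon> i * P $ b $ i)" for a b
      unfolding Ginv by (simp add: E_def matrix_matrix_mult_def transpose_def if_distrib cong: if_cong)
    then have "(\<Sum>a\<in>UNIV. \<Sum>b\<in>UNIV. matrix_inv G $ a $ b * Q $ a $ b)
        = (\<Sum>a\<in>UNIV. \<Sum>b\<in>UNIV. \<Sum>i\<in>UNIV. P $ a $ i * \<epsilon> i * P $ b $ i * Q $ a $ b)"
      by (simp add: sum_distrib_right)
    also have "\<dots> = (\<Sum>a\<in>UNIV. \<Sum>i\<in>UNIV. \<Sum>b\<in>UNIV. P $ a $ i * \<epsilon> i * P $ b $ i * Q $ a $ b)"
      by (intro sum.cong refl sum.swap)
    also have "\<dots> = (\<Sum>i\<in>UNIV. \<Sum>a\<in>UNIV. \<Sum>b\<in>UNIV. P $ a $ i * \<epsilon> i * P $ b $ i * Q $ a $ b)"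
      by (rule sum.swap)
    also have "\<dots> = (\<Sum>i\<in>UNIV. \<Sum>b\<in>UNIV. \<Sum>a\<in>UNIV. P $ a $ i * \<epsilon> i * P $ b $ i * Q $ a $ b)"
      by (intro sum.cong refl sum.swap)
    also have "\<dots> = (\<Sum>i\<in>UNIV. \<epsilon> i * Q' $ i $ i)"
      by (intro sum.cong refl)
        (simp add: Q'_def matrix_matrix_mult_def transpose_def sum_distrib_left sum_distrib_right mult_ac)
    finally show ?thesis .
  qed
  moreover have "(\<Sum>i\<in>UNIV. \<epsilon> i * Q' $ i $ i) = Q' $ k $ k - (\<Sum>i\<in>UNIV - {k}. Q' $ i $ i)"
    by (subst sum.remove[of _ k]) (auto simp: \<epsilon>_def sum_negf[symmetric] intro!: sum.cong)
  ultimately show ?thesis by simp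
qed

section \<open>Pseudo-Finsler metrics in a chart\<close>

definition gradient :: "'n::finite fld \<Rightarrow> 'n fld \<Rightarrow> 'n \<Rightarrow> 'n fld" where
  "gradient F f a z = (\<Sum>b\<in>UNIV. g_up F a b z * dy b f z)"

text \<open>As \<open>2 C\<^sub>a\<close> is the logarithmic derivative of \<open>|det g|\<close> along the fibre, this is the divergence
  with respect to the density \<open>|det g|\<close>.\<close>

definition divergence :: "'n::finite fld \<Rightarrow> ('n \<Rightarrow> 'n fld) \<Rightarrow> 'n fld" where
  "divergence F V z = (\<Sum>a\<in>UNIV. dy a (V a) z) + 2 * (\<Sum>a\<in>UNIV. mean_cartan F a z * V a z)"

text \<open>For the fields \<open>Z\<close> of interest this function is \<open>y\<^sub>a Z\<^sup>a / F\<close> (lemma \<open>eta_radial\<close>), and it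
  determines \<open>Z\<close> (lemma \<open>Z_eq\<close>). The expression as a divergence has no \<open>F\<close> in the denominator and
  so stays smooth where \<open>F\<close> vanishes.\<close>

definition potential :: "'n::finite fld \<Rightarrow> ('n \<Rightarrow> 'n fld) \<Rightarrow> 'n fld" where
  "potential F Z z = divergence F Z z / (real CARD('n) + 2)"

lemma
  assumes S: "open S" "z \<in> S" and FG: "\<And>w. w \<in> S \<Longrightarrow> F w = G w"
  shows gmat_cong: "gmat F z = gmat G z"
    and conn_cong: "conn F k i z = conn G k i z"
    and mean_cartan_cong: "mean_cartan F i z = mean_cartan G i z"
proof -
  have gmat: "gmat F w = gmat G w" if "w \<in> S" for w
    using that by (simp add: gmat_def vec_eq_iff dy_cong[OF S(1) _ dy_cong[OF S(1) _ FG]])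
  then show "gmat F z = gmat G z" using S by blast
  have g: "g_lo F i j w = g_lo G i j w" "g_up F i j w = g_up G i j w" if "w \<in> S" for i j w
    using gmat[OF that] by (simp_all add: g_lo_def g_up_def)
  have "spray F i w = spray G i w" if "w \<in> S" for i w
    using that g by (simp add: spray_def dx_cong[OF S(1) that g(1)])
  then show "conn F k i z = conn G k i z"
    unfolding conn_def using dy_cong[OF S] by blast
  show "mean_cartan F i z = mean_cartan G i z"
    using S(2) by (simp add: mean_cartan_def cartan_def g dy_cong[OF S g(1)])
qed

lemma divergence_cong:
  assumes "open S" "z \<in> S" "\<And>w. w \<in> S \<Longrightarrow> F w = G w" "\<And>a w. w \<in> S \<Longrightarrow> U a w = V a w"
  shows "divergence F U z = divergence G V z"
proof -
  have "dy a (U a) z = dy a (V a) z" for a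
    using assms(1,2,4) by (rule dy_cong)
  then show ?thesis
    using assms(2,4) mean_cartan_cong[OF assms(1-3)] by (simp add: divergence_def)
qed

lemma gradient_cong:
  assumes "open S" "z \<in> S" "\<And>w. w \<in> S \<Longrightarrow> F w = G w" "\<And>w. w \<in> S \<Longrightarrow> f w = h w"
  shows "gradient F f a z = gradient G h a z"
  using gmat_cong[OF assms(1-3)] dy_cong[OF assms(1,2,4)]
  by (simp add: gradient_def g_up_def)

text \<open>Homogeneity and positivity of \<open>F\<close> are kept out of this locale so that it also applies to an
  extension of a metric to a neighbourhood of a boundary point.\<close>

locale metric_chart =
  fixes R :: "((real ^ 'n::finite) \<times> (real ^ 'n)) set" and F :: "'n fld"
  assumes open_R: "open R" and smooth_F: "smooth_on F R"
    and nondegenerate: "z \<in> R \<Longrightarrow> invertible (gmat F z)"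
begin

lemma smooth_g_lo: "smooth_on (g_lo F i j) R"
proof -
  have "g_lo F i j = (\<lambda>z. 1/2 * dy j (dy i F) z)"
    by (rule ext) (simp add: g_lo_def gmat_def)
  moreover have "smooth_on (\<lambda>z. 1/2 * dy j (dy i F) z) R"
    by (intro smooth_intros open_R smooth_F)
  ultimately show ?thesis by simp
qed

lemma smooth_g_up: "smooth_on (g_up F i j) R"
proof -
  have "g_up F i j = (\<lambda>z. matrix_inv (gmat F z) $ i $ j)"
    by (rule ext) (simp add: g_up_def)
  moreover have "smooth_on (\<lambda>z. matrix_inv (gmat F z) $ i $ j) R"
    using smooth_g_lo unfolding g_lo_def[abs_def] by (intro smooth_on_matrix_inv open_R nondegenerate)
  ultimately show ?thesis by simp
qed

lemma smooth_y_lo: "smooth_on (y_lo F i) R"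
  unfolding y_lo_def[abs_def] by (intro smooth_intros open_R smooth_g_lo)

lemma smooth_conn: "smooth_on (conn F k i) R"
  unfolding conn_def spray_def[abs_def]
  by (intro smooth_intros open_R smooth_g_lo smooth_g_up)

lemma smooth_cartan: "smooth_on (cartan F i j k) R"
  unfolding cartan_def[abs_def] by (intro smooth_intros open_R smooth_g_lo)

lemma smooth_mean_cartan: "smooth_on (mean_cartan F i) R"
  unfolding mean_cartan_def[abs_def] by (intro smooth_intros open_R smooth_g_up smooth_cartan)

lemma smooth_gradient: "smooth_on f R \<Longrightarrow> smooth_on (gradient F f a) R"
  unfolding gradient_def[abs_def] by (intro smooth_intros open_R smooth_g_up)

lemma smooth_divergence: "(\<And>a. smooth_on (V a) R) \<Longrightarrow> smooth_on (divergence F V) R"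
  unfolding divergence_def[abs_def] by (intro smooth_intros open_R smooth_mean_cartan)

lemma smooth_potential: "(\<And>a. smooth_on (Z a) R) \<Longrightarrow> smooth_on (potential F Z) R"
  unfolding potential_def[abs_def]
  by (intro smooth_on_divide smooth_divergence open_R smooth_on_const) auto

lemmas diff = smooth_on_imp_differentiable

lemma g_lo_sym: "z \<in> R \<Longrightarrow> g_lo F i j z = g_lo F j i z"
  unfolding g_lo_def gmat_def using dy_commute[OF smooth_F open_R] by simp

lemma g_up_g_lo:
  assumes "z \<in> R"
  shows "(\<Sum>b\<in>UNIV. g_up F a b z * g_lo F b c z) = kdelta a c"
proof -
  have "(matrix_inv (gmat F z) ** gmat F z) $ a $ c = mat 1 $ a $ c"
    using matrix_inv_inverse(2)[OF nondegenerate[OF assms]] by simp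
  then show ?thesis
    by (simp add: g_up_def g_lo_def matrix_matrix_mult_def mat_def kdelta_def)
qed

lemma g_up_sym:
  assumes "z \<in> R"
  shows "g_up F a b z = g_up F b a z"
proof -
  let ?G = "gmat F z"
  have G: "transpose ?G = ?G"
    using g_lo_sym[OF assms] by (simp add: transpose_def vec_eq_iff g_lo_def)
  have inv: "?G ** matrix_inv ?G = mat 1" "matrix_inv ?G ** ?G = mat 1"
    using matrix_inv_inverse[OF nondegenerate[OF assms]] by auto
  have "transpose (matrix_inv ?G) = transpose (matrix_inv ?G) ** (?G ** matrix_inv ?G)"
    by (simp add: inv)
  also have "\<dots> = transpose (?G ** matrix_inv ?G) ** matrix_inv ?G"
    by (simp add: matrix_transpose_mul G matrix_mul_assoc)
  finally have "transpose (matrix_inv ?G) = matrix_inv ?G"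
    by (simp add: inv)
  then show ?thesis unfolding g_up_def by (metis transpose_def vec_lambda_beta)
qed

lemma sum_kdelta [simp]:
  fixes f :: "'n \<Rightarrow> real"
  shows "(\<Sum>b\<in>UNIV. kdelta a b * f b) = f a" "(\<Sum>b\<in>UNIV. kdelta b a * f b) = f a"
  by (simp_all add: kdelta_def if_distrib[of "\<lambda>x. x * _"] cong: if_cong)

end

locale cone_chart = metric_chart R F
  for R :: "((real ^ 'n::finite) \<times> (real ^ 'n)) set" and F :: "'n fld" +
  assumes conic_R: "conic R" and homogeneous_F: "homogeneous 2 R F"
begin

lemma homogeneous_g_lo: "homogeneous 0 R (g_lo F i j)"
proof -
  have "g_lo F i j = (\<lambda>z. 1/2 * dy j (dy i F) z)"
    by (rule ext) (simp add: g_lo_def gmat_def)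
  moreover have "homogeneous 0 R (\<lambda>z. 1/2 * dy j (dy i F) z)"
    by (intro homogeneous_cmult homogeneous_dy[where d = 1] homogeneous_dy[where d = 2]
      open_R conic_R smooth_on_dy smooth_F homogeneous_F) auto
  ultimately show ?thesis by simp
qed

lemma homogeneous_g_up: "homogeneous 0 R (g_up F i j)"
proof -
  have "gmat F (x, t *\<^sub>R y) = gmat F (x, y)" if "(x, y) \<in> R" "t > 0" for x y and t :: real
    using homogeneousD[OF homogeneous_g_lo that] by (simp add: vec_eq_iff g_lo_def)
  then show ?thesis unfolding homogeneous_def g_up_def by simp
qed

lemma homogeneous_mean_cartan: "homogeneous (-1) R (mean_cartan F i)"
  unfolding mean_cartan_def[abs_def] cartan_def
  by (intro homogeneous_sum homogeneous_cmult homogeneous_mult[where d = 0 and e = "-1"]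
    homogeneous_dy[where d = 0] homogeneous_g_up homogeneous_g_lo open_R conic_R smooth_g_lo) auto

lemma homogeneous_divergence:
  assumes "\<And>a. smooth_on (V a) R" "\<And>a. homogeneous d R (V a)" "e = d - 1"
  shows "homogeneous e R (divergence F V)"
  unfolding divergence_def[abs_def]
  by (intro homogeneous_add homogeneous_sum homogeneous_cmult homogeneous_mult[where d = "-1" and e = d]
    homogeneous_dy[where d = d] homogeneous_mean_cartan open_R conic_R assms) (use assms in auto)

lemma y_lo_eq:
  assumes "z \<in> R"
  shows "y_lo F i z = 1/2 * dy i F z"
proof -
  have "homogeneous 1 R (dy i F)"
    using homogeneous_dy[OF open_R conic_R smooth_F homogeneous_F] by simp
  from euler_homogeneous[OF open_R smooth_on_dy[OF smooth_F] this assms]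
  show ?thesis
    by (simp add: y_lo_def g_lo_def gmat_def sum_divide_distrib[symmetric])
qed

lemma y_lo_contract: "z \<in> R \<Longrightarrow> (\<Sum>i\<in>UNIV. y_lo F i z * snd z $ i) = F z"
  using euler_homogeneous[OF open_R smooth_F homogeneous_F]
  by (simp add: y_lo_eq sum_divide_distrib[symmetric])

lemma dy_y_lo:
  assumes "z \<in> R"
  shows "dy c (y_lo F b) z = g_lo F b c z"
proof -
  have "dy c (y_lo F b) z = dy c (\<lambda>z. 1/2 * dy b F z) z"
    by (rule dy_cong[OF open_R assms y_lo_eq])
  also have "\<dots> = 1/2 * dy c (dy b F) z"
    by (rule dy_cmult) (rule diff[OF smooth_on_dy[OF smooth_F] assms])
  finally show ?thesis by (simp add: g_lo_def gmat_def)
qed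

lemma raise_y_lo:
  assumes "z \<in> R"
  shows "(\<Sum>b\<in>UNIV. g_up F a b z * y_lo F b z) = snd z $ a"
proof -
  have "(\<Sum>b\<in>UNIV. g_up F a b z * y_lo F b z)
      = (\<Sum>b\<in>UNIV. \<Sum>c\<in>UNIV. g_up F a b z * g_lo F b c z * snd z $ c)"
    by (simp add: y_lo_def sum_distrib_left mult_ac)
  also have "\<dots> = (\<Sum>c\<in>UNIV. (\<Sum>b\<in>UNIV. g_up F a b z * g_lo F b c z) * snd z $ c)"
    by (subst sum.swap) (simp add: sum_distrib_right)
  also have "\<dots> = snd z $ a" by (simp add: g_up_g_lo[OF assms])
  finally show ?thesis .
qed

text \<open>The components \<open>g\<^sub>b\<^sub>c\<close> have degree 0, so their derivatives vanish in the direction of \<open>y\<close>.\<close>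

lemma mean_cartan_contract:
  assumes "z \<in> R"
  shows "(\<Sum>i\<in>UNIV. mean_cartan F i z * snd z $ i) = 0"
proof -
  have C: "(\<Sum>i\<in>UNIV. cartan F a b i z * snd z $ i) = 0" for a b
    using euler_homogeneous[OF open_R smooth_g_lo homogeneous_g_lo assms]
    by (simp add: cartan_def sum_distrib_left[symmetric] sum_divide_distrib[symmetric] mult.assoc)
  have "(\<Sum>i\<in>UNIV. mean_cartan F i z * snd z $ i)
      = (\<Sum>i\<in>UNIV. \<Sum>a\<in>UNIV. \<Sum>b\<in>UNIV. g_up F a b z * (cartan F a b i z * snd z $ i))"
    by (simp add: mean_cartan_def sum_distrib_right mult.assoc)
  also have "\<dots> = (\<Sum>a\<in>UNIV. \<Sum>i\<in>UNIV. \<Sum>b\<in>UNIV. g_up F a b z * (cartan F a b i z * snd z $ i))"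
    by (rule sum.swap)
  also have "\<dots> = (\<Sum>a\<in>UNIV. \<Sum>b\<in>UNIV. \<Sum>i\<in>UNIV. g_up F a b z * (cartan F a b i z * snd z $ i))"
    by (intro sum.cong refl sum.swap)
  also have "\<dots> = 0" by (simp add: sum_distrib_left[symmetric] C)
  finally show ?thesis .
qed

text \<open>Differentiate \<open>g\<^sup>a\<^sup>b y\<^sub>b = y\<^sup>a\<close>: the derivative of \<open>y\<^sub>b\<close> is \<open>g\<^sub>b\<^sub>c\<close>, which already accounts for the
  whole right-hand side.\<close>

lemma dy_g_up_y_lo:
  assumes "z \<in> R"
  shows "(\<Sum>b\<in>UNIV. dy c (g_up F a b) z * y_lo F b z) = 0"
proof -
  have "kdelta c a = dy c (\<lambda>z. \<Sum>b\<in>UNIV. g_up F a b z * y_lo F b z) z"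
    unfolding dy_fibre_coordinate[of c a z, symmetric]
    by (rule dy_cong[OF open_R assms]) (simp add: raise_y_lo)
  also have "\<dots> = (\<Sum>b\<in>UNIV. dy c (\<lambda>z. g_up F a b z * y_lo F b z) z)"
    by (intro dy_sum differentiable_mult diff[OF smooth_g_up assms] diff[OF smooth_y_lo assms])
  also have "\<dots> = (\<Sum>b\<in>UNIV. g_up F a b z * g_lo F b c z + dy c (g_up F a b) z * y_lo F b z)"
    using assms by (simp add: dy_mult diff[OF smooth_g_up assms] diff[OF smooth_y_lo assms] dy_y_lo)
  also have "\<dots> = kdelta a c + (\<Sum>b\<in>UNIV. dy c (g_up F a b) z * y_lo F b z)"
    by (simp add: sum.distrib g_up_g_lo[OF assms])
  finally show ?thesis by (auto simp: kdelta_def split: if_splits)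
qed

end

section \<open>The reduced affine equation\<close>

text \<open>The equation \<open>reduced\<close> is what remains of the affine equation for the difference tensor
  \<open>J k i = dy i (Z k)\<close> once the mean Landsberg tensor has been eliminated. It involves derivatives along
  the fibre only.\<close>

locale reduced_equation = cone_chart R F
  for R :: "((real ^ 'n::finite) \<times> (real ^ 'n)) set" and F :: "'n fld" +
  fixes Z :: "'n::finite \<Rightarrow> 'n fld"
  assumes F_pos: "z \<in> R \<Longrightarrow> F z > 0"
    and smooth_Z: "smooth_on (Z a) R" and homogeneous_Z: "homogeneous 2 R (Z a)"
    and reduced: "z \<in> R \<Longrightarrow>
      (\<Sum>a\<in>UNIV. y_lo F a z * dy b (Z a) z) = 2 * F z * dy b (potential F Z) z"
begin

abbreviation "\<eta> \<equiv> potential F Z"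

lemma smooth_eta: "smooth_on \<eta> R"
  by (intro smooth_potential smooth_Z)

lemma homogeneous_eta: "homogeneous 1 R \<eta>"
proof -
  have "homogeneous 1 R (\<lambda>z. (1 / (real CARD('n) + 2)) * divergence F Z z)"
    by (intro homogeneous_cmult homogeneous_divergence[where d = 2] smooth_Z homogeneous_Z) simp
  then show ?thesis by (simp add: potential_def[abs_def])
qed

lemma euler_eta: "z \<in> R \<Longrightarrow> (\<Sum>b\<in>UNIV. dy b \<eta> z * snd z $ b) = \<eta> z"
  using euler_homogeneous[OF open_R smooth_eta homogeneous_eta] by simp

text \<open>Contract the reduced equation with \<open>y\<^sup>b\<close> and apply Euler's relation to \<open>\<eta>\<close> (degree 1) and
  \<open>Z\<close> (degree 2).\<close>

lemma eta_radial:
  assumes "z \<in> R"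
  shows "(\<Sum>a\<in>UNIV. y_lo F a z * Z a z) = F z * \<eta> z"
proof -
  have "2 * F z * \<eta> z = (\<Sum>b\<in>UNIV. (\<Sum>a\<in>UNIV. y_lo F a z * dy b (Z a) z) * snd z $ b)"
    by (simp add: reduced[OF assms] mult.assoc sum_distrib_left[symmetric] euler_eta[OF assms])
  also have "\<dots> = (\<Sum>a\<in>UNIV. y_lo F a z * (\<Sum>b\<in>UNIV. dy b (Z a) z * snd z $ b))"
    by (simp add: sum_distrib_left sum_distrib_right mult.assoc) (rule sum.swap)
  also have "\<dots> = 2 * (\<Sum>a\<in>UNIV. y_lo F a z * Z a z)"
    using euler_homogeneous[OF open_R smooth_Z homogeneous_Z assms]
    by (simp add: sum_distrib_left mult_ac)
  finally show ?thesis by simp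
qed

text \<open>Differentiate \<open>eta_radial\<close> and subtract the reduced equation: the derivatives of \<open>Z\<close> cancel, so
  \<open>Z\<close> itself is expressed by \<open>\<eta>\<close> and its first derivatives.\<close>

lemma lower_Z:
  assumes "z \<in> R"
  shows "(\<Sum>a\<in>UNIV. g_lo F a b z * Z a z) = 2 * \<eta> z * y_lo F b z - F z * dy b \<eta> z"
proof -
  have "dy b (\<lambda>z. \<Sum>a\<in>UNIV. y_lo F a z * Z a z) z = dy b (\<lambda>z. F z * \<eta> z) z"
    by (rule dy_cong[OF open_R assms eta_radial])
  moreover have "dy b (\<lambda>z. F z * \<eta> z) z = F z * dy b \<eta> z + 2 * y_lo F b z * \<eta> z"
    by (simp add: dy_mult diff[OF smooth_F assms] diff[OF smooth_eta assms] y_lo_eq[OF assms])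
  moreover have "dy b (\<lambda>z. \<Sum>a\<in>UNIV. y_lo F a z * Z a z) z
      = (\<Sum>a\<in>UNIV. y_lo F a z * dy b (Z a) z) + (\<Sum>a\<in>UNIV. g_lo F a b z * Z a z)"
    by (simp add: dy_sum dy_mult differentiable_mult diff[OF smooth_y_lo assms] diff[OF smooth_Z assms]
      dy_y_lo[OF assms] sum.distrib)
  ultimately show ?thesis using reduced[OF assms, of b] by (simp add: algebra_simps)
qed

lemma Z_eq:
  assumes "z \<in> R"
  shows "Z a z = 2 * \<eta> z * snd z $ a - F z * gradient F \<eta> a z"
proof -
  have "Z a z = (\<Sum>c\<in>UNIV. kdelta a c * Z c z)" by simp
  also have "\<dots> = (\<Sum>c\<in>UNIV. \<Sum>b\<in>UNIV. g_up F a b z * (g_lo F c b z * Z c z))"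
    by (simp add: g_up_g_lo[OF assms, symmetric] sum_distrib_right g_lo_sym[OF assms] mult.assoc)
  also have "\<dots> = (\<Sum>b\<in>UNIV. g_up F a b z * (\<Sum>c\<in>UNIV. g_lo F c b z * Z c z))"
    by (subst sum.swap) (simp add: sum_distrib_left)
  also have "\<dots> = 2 * \<eta> z * (\<Sum>b\<in>UNIV. g_up F a b z * y_lo F b z) - F z * gradient F \<eta> a z"
    unfolding lower_Z[OF assms]
    by (simp add: gradient_def right_diff_distrib sum_subtractf sum_distrib_left mult_ac)
  finally show ?thesis by (simp add: raise_y_lo[OF assms])
qed

lemma y_lo_gradient:
  assumes "z \<in> R"
  shows "(\<Sum>a\<in>UNIV. y_lo F a z * gradient F \<eta> a z) = \<eta> z"
proof -
  have "(\<Sum>a\<in>UNIV. y_lo F a z * gradient F \<eta> a z)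
      = (\<Sum>a\<in>UNIV. \<Sum>b\<in>UNIV. dy b \<eta> z * (g_up F b a z * y_lo F a z))"
    unfolding gradient_def sum_distrib_left
    by (intro sum.cong refl) (subst g_up_sym[OF assms], simp)
  also have "\<dots> = (\<Sum>b\<in>UNIV. dy b \<eta> z * (\<Sum>a\<in>UNIV. g_up F b a z * y_lo F a z))"
    by (rule trans[OF sum.swap]) (simp add: sum_distrib_left)
  finally show ?thesis by (simp add: raise_y_lo[OF assms] euler_eta[OF assms])
qed

text \<open>Inserting \<open>Z_eq\<close> into the definition of \<open>\<eta>\<close> as a divergence of \<open>Z\<close> gives a linear second order
  equation. It serves twice: near the boundary it shows that \<open>\<eta>\<close> is divisible by \<open>F\<close> when the
  dimension is not 2, and in the interior it supports a maximum principle.\<close>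

lemma eta_equation:
  assumes "z \<in> R"
  shows "(real CARD('n) - 2) * \<eta> z = F z * divergence F (gradient F \<eta>) z"
proof -
  note d = diff[OF smooth_F assms] diff[OF smooth_eta assms] diff[OF smooth_on_fibre_coordinate assms]
    diff[OF smooth_gradient[OF smooth_eta] assms]
  have dZ: "dy a (Z a) z = 2 * (snd z $ a * dy a \<eta> z + \<eta> z)
      - (F z * dy a (gradient F \<eta> a) z + 2 * (y_lo F a z * gradient F \<eta> a z))" for a
  proof -
    have "dy a (Z a) z = dy a (\<lambda>z. 2 * \<eta> z * snd z $ a - F z * gradient F \<eta> a z) z"
      by (rule dy_cong[OF open_R assms Z_eq])
    also have "\<dots> = dy a (\<lambda>z. 2 * (\<eta> z * snd z $ a)) z - dy a (\<lambda>z. F z * gradient F \<eta> a z) z"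
      by (simp add: dy_diff differentiable_mult d mult.assoc)
    also have "\<dots> = 2 * (snd z $ a * dy a \<eta> z + \<eta> z)
      - (F z * dy a (gradient F \<eta> a) z + 2 * (y_lo F a z * gradient F \<eta> a z))"
      by (simp add: dy_mult dy_cmult differentiable_mult d dy_fibre_coordinate kdelta_def y_lo_eq[OF assms])
    finally show ?thesis .
  qed
  have "(\<Sum>a\<in>UNIV. dy a (Z a) z) = 2 * (\<eta> z + real CARD('n) * \<eta> z)
      - (F z * (\<Sum>a\<in>UNIV. dy a (gradient F \<eta> a) z) + 2 * \<eta> z)"
    unfolding dZ
    by (simp add: sum_subtractf sum.distrib sum_distrib_left[symmetric] y_lo_gradient[OF assms]
      mult.commute[of "snd z $ _"] euler_eta[OF assms])
  moreover have "(\<Sum>a\<in>UNIV. mean_cartan F a z * Z a z)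
      = - F z * (\<Sum>a\<in>UNIV. mean_cartan F a z * gradient F \<eta> a z)"
  proof -
    have "(\<Sum>a\<in>UNIV. mean_cartan F a z * Z a z)
        = 2 * \<eta> z * (\<Sum>a\<in>UNIV. mean_cartan F a z * snd z $ a)
          - F z * (\<Sum>a\<in>UNIV. mean_cartan F a z * gradient F \<eta> a z)"
      by (simp add: Z_eq[OF assms] right_diff_distrib sum_subtractf sum_distrib_left mult_ac)
    then show ?thesis by (simp add: mean_cartan_contract[OF assms])
  qed
  moreover have "divergence F Z z = (real CARD('n) + 2) * \<eta> z"
    by (simp add: potential_def)
  ultimately show ?thesis by (simp add: divergence_def algebra_simps)
qed

end

context cone_chart
begin

text \<open>Since \<open>J k i = dy i (Z k)\<close> has symmetric fibre derivatives, the last term of the affine equation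
  drops out and the equation says \<open>\<omega>\<^sub>i y\<^sup>j = (\<omega>\<^sub>b y\<^sup>b) \<delta>\<^sup>j\<^sub>i\<close> for the covector \<open>\<omega>\<close> in braces. Its trace
  gives \<open>\<omega>\<^sub>b y\<^sup>b = 0\<close>, hence \<open>\<omega> = 0\<close>. After elimination of the mean Landsberg
  tensor, all terms except the one with \<open>y\<^sub>a\<close> combine into a single fibre derivative.\<close>

lemma affine_imp_reduced:
  assumes n: "CARD('n) \<ge> 2" and Z: "\<And>a. smooth_on (Z a) R" and F: "F z \<noteq> 0"
    and J: "\<And>w k i. w \<in> R \<Longrightarrow> J k i w = dy i (Z k) w"
    and affine: "affine_equation_at F J z" and z: "z \<in> R" "snd z \<noteq> 0"
    and lan: "2 * (\<Sum>a\<in>UNIV. dy b (mean_cartan F a) z * Z a z)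
      + (\<Sum>a\<in>UNIV. mean_cartan F a z * dy b (Z a) z) + mean_landsberg F b z = 0"
  shows "(\<Sum>a\<in>UNIV. y_lo F a z * dy b (Z a) z) = 2 * F z * dy b (potential F Z) z"
proof -
  note dZ = diff[OF Z z(1)] and ddZ = diff[OF smooth_on_dy[OF Z] z(1)]
    and dC = diff[OF smooth_mean_cartan z(1)]
  have dJ: "dy a (J k i) z = dy a (dy i (Z k)) z" for a k i
    by (rule dy_cong[OF open_R z(1) J])
  have comm: "dy a (dy i (Z k)) z = dy i (dy a (Z k)) z" for a i k
    by (rule dy_commute[OF Z open_R z(1)])
  define \<omega> where "\<omega> b = affine_covector F J b z" for b
  define S where "S = (\<Sum>b\<in>UNIV. \<omega> b * snd z $ b)"
  have eq: "\<omega> i * snd z $ j = kdelta j i * S" for i j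
  proof -
    have "(\<Sum>a\<in>UNIV. (dy a (J j i) z - dy i (J j a) z) * snd z $ a) = 0"
      by (simp add: dJ comm[of _ i])
    then have "(\<Sum>b\<in>UNIV. \<omega> b * (kdelta b i * snd z $ j - snd z $ b * kdelta j i)) = 0"
      using affine[unfolded affine_equation_at_def, rule_format, of i j] by (simp add: \<omega>_def)
    moreover have "(\<Sum>b\<in>UNIV. \<omega> b * (kdelta b i * snd z $ j - snd z $ b * kdelta j i))
        = (\<Sum>b\<in>UNIV. kdelta b i * \<omega> b) * snd z $ j - kdelta j i * S"
      by (simp only: right_diff_distrib sum_subtractf sum_distrib_left sum_distrib_right S_def mult_ac)
    ultimately show ?thesis by simp
  qed
  have "S = real CARD('n) * S"
  proof -
    have "S = (\<Sum>i\<in>(UNIV :: 'n set). kdelta i i * S)"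
      by (subst S_def) (rule sum.cong[OF refl eq])
    then show ?thesis by (simp add: kdelta_def)
  qed
  then have "S = 0" using n by simp
  obtain j where "snd z $ j \<noteq> 0" using z(2) by (metis vec_eq_iff zero_index)
  then have "\<omega> b = 0" using eq[of b j] \<open>S = 0\<close> by simp
  then have 1: "2 * mean_landsberg F b z
      + (real CARD('n) + 2) * ((\<Sum>a\<in>UNIV. y_lo F a z * dy b (Z a) z) / F z)
      - 2 * (\<Sum>a\<in>UNIV. mean_cartan F a z * dy b (Z a) z)
      - 2 * (\<Sum>a\<in>UNIV. dy b (dy a (Z a)) z) = 0"
    by (simp add: \<omega>_def affine_covector_def J[OF z(1)] dJ comm[of _ b]
      sum_divide_distrib sum_distrib_left)
  have "dy b (potential F Z) z = dy b (\<lambda>w. 1 / (real CARD('n) + 2) * divergence F Z w) z"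
    by (simp add: potential_def[abs_def])
  also have "\<dots> = 1 / (real CARD('n) + 2) * dy b (divergence F Z) z"
    by (rule dy_cmult) (rule diff[OF smooth_divergence[OF Z] z(1)])
  also have "dy b (divergence F Z) z = (\<Sum>a\<in>UNIV. dy b (dy a (Z a)) z)
      + 2 * ((\<Sum>a\<in>UNIV. mean_cartan F a z * dy b (Z a) z)
        + (\<Sum>a\<in>UNIV. dy b (mean_cartan F a) z * Z a z))"
    unfolding divergence_def[abs_def]
    by (simp add: dy_add dy_cmult dy_sum dy_mult differentiable_mult differentiable_add
      differentiable_sum dZ ddZ dC sum.distrib)
  finally have 2: "(real CARD('n) + 2) * dy b (potential F Z) z = (\<Sum>a\<in>UNIV. dy b (dy a (Z a)) z)
      + 2 * ((\<Sum>a\<in>UNIV. mean_cartan F a z * dy b (Z a) z)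
        + (\<Sum>a\<in>UNIV. dy b (mean_cartan F a) z * Z a z))" by simp
  have combine: "m * X = m * (2 * P)" if "2 * l + m * X - 2 * C - 2 * D = 0" "2 * E + C + l = 0"
    "m * P = D + 2 * (C + E)" for m X P l C D E :: real
    using that by algebra
  have "real CARD('n) + 2 \<noteq> 0" by linarith
  then have "(\<Sum>a\<in>UNIV. y_lo F a z * dy b (Z a) z) / F z = 2 * dy b (potential F Z) z"
    using combine[OF 1 lan 2] unfolding mult_cancel_left by blast
  then show ?thesis using F by (simp add: field_simps)
qed

end

section \<open>Maximum principle and boundary behaviour\<close>

context reduced_equation
begin

text \<open>The maximum principle for \<open>\<eta>\<^sup>2 / F\<close> on a fibre. If \<open>M\<close> is the maximal value, the function
  \<open>q = M F - \<eta>\<^sup>2\<close> has minimal value 0 at the point in question, so its Hessian is positive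
  semidefinite there; \<open>q\<close> has degree 2, so the Hessian annihilates the timelike vector \<open>y\<close>. Hence its
  trace with respect to \<open>g\<close> is at most 0. But \<open>eta_equation\<close> makes this trace equal to \<open>2 M\<close>.
  Working with \<open>q\<close> instead of the quotient keeps the Hessian polynomial in \<open>\<eta>\<close>, \<open>F\<close> and their
  derivatives.\<close>

lemma no_interior_maximum:
  assumes z: "z \<in> R" and lorentz: "lorentzian (gmat F z)" and nz: "\<eta> z \<noteq> 0"
    and max: "\<And>y. (fst z, y) \<in> R \<Longrightarrow> (\<eta> (fst z, y))\<^sup>2 * F z \<le> (\<eta> z)\<^sup>2 * F (fst z, y)"
  shows False
proof -
  define M where "M = (\<eta> z)\<^sup>2 / F z"
  define q where "q w = M * F w - \<eta> w * \<eta> w" for w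
  have Fz: "F z > 0" using F_pos[OF z] .
  have smq: "smooth_on q R"
    unfolding q_def by (intro smooth_intros open_R smooth_F smooth_eta)
  have "homogeneous 2 R (\<lambda>w. M * F w + (-1) * (\<eta> w * \<eta> w))"
    by (intro homogeneous_add homogeneous_cmult homogeneous_F
      homogeneous_mult[OF homogeneous_eta homogeneous_eta]) simp
  then have homq: "homogeneous 2 R q" by (simp add: q_def[abs_def])
  have qz: "q z = 0" using Fz by (simp add: q_def M_def power2_eq_square)
  have qmin: "q z \<le> q (z + t *\<^sub>R (0, w))" if "z + t *\<^sub>R (0, w) \<in> R" for t w
  proof -
    have zt: "z + t *\<^sub>R (0, w) = (fst z, snd z + t *\<^sub>R w)" by (simp add: prod_eq_iff)
    have "(\<eta> (fst z, snd z + t *\<^sub>R w))\<^sup>2 \<le> M * F (fst z, snd z + t *\<^sub>R w)"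
      using max[of "snd z + t *\<^sub>R w"] that Fz unfolding zt by (simp add: M_def field_simps)
    then show ?thesis unfolding qz zt by (simp add: q_def power2_eq_square)
  qed
  have dq: "dy b q z = 0" for b
    unfolding dy_eq_dirderiv
    by (rule second_derivative_at_minimum(1)[OF open_R smq z]) (rule qmin)
  define Q where "Q = (\<chi> a b. dy a (dy b q) z)"
  have psd: "w \<bullet> (Q *v w) \<ge> 0" for w
  proof -
    have "0 \<le> dirderiv (0, w) (dirderiv (0, w) q) z"
      by (rule second_derivative_at_minimum(2)[OF open_R smq z]) (rule qmin)
    also have "\<dots> = (\<Sum>a\<in>UNIV. w $ a * dy a (dirderiv (0, w) q) z)"
      by (rule dirderiv_vertical[OF diff[OF smooth_on_dirderiv[OF smq] z]])
    also have "\<dots> = (\<Sum>a\<in>UNIV. w $ a * dy a (\<lambda>v. \<Sum>b\<in>UNIV. w $ b * dy b q v) z)"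
      by (intro sum.cong refl arg_cong2[of _ _ _ _ "(*)"] dy_cong[OF open_R z])
        (rule dirderiv_vertical[OF diff[OF smq]])
    also have "\<dots> = (\<Sum>a\<in>UNIV. w $ a * (\<Sum>b\<in>UNIV. w $ b * dy a (dy b q) z))"
      by (simp add: dy_sum dy_cmult differentiable_mult diff[OF smooth_on_dy[OF smq] z])
    also have "\<dots> = w \<bullet> (Q *v w)"
      by (simp add: Q_def inner_vec_def matrix_vector_mult_def mult_ac)
    finally show ?thesis .
  qed
  have sym: "transpose Q = Q"
    by (simp add: Q_def transpose_def vec_eq_iff dy_commute[OF smq open_R z])
  have ker: "Q *v snd z = 0"
  proof -
    have "(\<Sum>b\<in>UNIV. dy a (dy b q) z * snd z $ b) = 0" for a
    proof -
      have "homogeneous 1 R (dy a q)"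
        using homogeneous_dy[OF open_R conic_R smq homq] by simp
      from euler_homogeneous[OF open_R smooth_on_dy[OF smq] this z]
      show ?thesis by (simp add: dq dy_commute[OF smq open_R z, of a])
    qed
    then show ?thesis by (simp add: Q_def vec_eq_iff matrix_vector_mult_def)
  qed
  have "snd z \<bullet> (gmat F z *v snd z) = F z"
    using y_lo_contract[OF z]
    by (simp add: inner_vec_def matrix_vector_mult_def y_lo_def g_lo_def mult.commute)
  then have trace: "(\<Sum>a\<in>UNIV. \<Sum>b\<in>UNIV. g_up F a b z * Q $ a $ b) \<le> 0"
    unfolding g_up_def using Fz by (intro lorentzian_trace_nonpos[OF lorentz _ sym psd ker]) simp
  define \<kappa> where "\<kappa> = \<eta> z / F z"
  have dyq: "dy b q w = M * dy b F w - 2 * (\<eta> w * dy b \<eta> w)" if "w \<in> R" for b w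
    unfolding q_def
    by (simp add: dy_diff dy_cmult dy_mult differentiable_mult diff[OF smooth_F that] diff[OF smooth_eta that])
  \<comment> \<open>The maximum is critical, so \<open>d\<eta>\<close> is a multiple of \<open>dF\<close>; this kills all first order terms.\<close>
  have deta: "dy b \<eta> z = \<kappa> * y_lo F b z" for b
    using dyq[OF z, of b] Fz nz
    by (simp add: dq M_def \<kappa>_def y_lo_eq[OF z] field_simps power2_eq_square)
  have Qab: "Q $ a $ b = 2 * M * g_lo F b a z - 2 * \<eta> z * dy a (dy b \<eta>) z
      - 2 * \<kappa>\<^sup>2 * (y_lo F a z * y_lo F b z)" for a b
  proof -
    have "Q $ a $ b = dy a (\<lambda>w. M * dy b F w - 2 * (\<eta> w * dy b \<eta> w)) z"
      unfolding Q_def using dy_cong[OF open_R z dyq] by simp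
    also have "\<dots> = M * dy a (dy b F) z - 2 * (\<eta> z * dy a (dy b \<eta>) z + dy a \<eta> z * dy b \<eta> z)"
      by (simp add: dy_diff dy_cmult dy_mult differentiable_mult diff[OF smooth_on_dy[OF smooth_F] z]
        diff[OF smooth_eta z] diff[OF smooth_on_dy[OF smooth_eta] z])
    also have "dy a (dy b F) z = 2 * g_lo F b a z" by (simp add: g_lo_def gmat_def)
    finally show ?thesis by (simp add: deta power2_eq_square algebra_simps)
  qed
  define H where "H = (\<Sum>a\<in>UNIV. \<Sum>b\<in>UNIV. g_up F a b z * dy a (dy b \<eta>) z)"
  have "divergence F (gradient F \<eta>) z = H"
  proof -
    have "dy a (gradient F \<eta> a) z = (\<Sum>b\<in>UNIV. g_up F a b z * dy a (dy b \<eta>) z)" for a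
    proof -
      have "dy a (gradient F \<eta> a) z = (\<Sum>b\<in>UNIV. g_up F a b z * dy a (dy b \<eta>) z)
          + (\<Sum>b\<in>UNIV. dy a (g_up F a b) z * dy b \<eta> z)"
        unfolding gradient_def[abs_def]
        by (simp add: dy_sum dy_mult differentiable_mult diff[OF smooth_g_up z]
          diff[OF smooth_on_dy[OF smooth_eta] z] sum.distrib)
      moreover have "(\<Sum>b\<in>UNIV. dy a (g_up F a b) z * dy b \<eta> z)
          = \<kappa> * (\<Sum>b\<in>UNIV. dy a (g_up F a b) z * y_lo F b z)"
        by (simp add: deta sum_distrib_left mult_ac)
      ultimately show ?thesis by (simp add: dy_g_up_y_lo[OF z])
    qed
    moreover have "gradient F \<eta> a z = \<kappa> * snd z $ a" for a
      by (simp add: gradient_def deta raise_y_lo[OF z, symmetric] sum_distrib_left mult_ac)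
    then have "(\<Sum>a\<in>UNIV. mean_cartan F a z * gradient F \<eta> a z)
        = \<kappa> * (\<Sum>a\<in>UNIV. mean_cartan F a z * snd z $ a)"
      by (simp add: sum_distrib_left mult_ac)
    ultimately show ?thesis by (simp add: divergence_def H_def mean_cartan_contract[OF z])
  qed
  then have H: "F z * H = (real CARD('n) - 2) * \<eta> z" using eta_equation[OF z] by simp
  have tr_g: "(\<Sum>a\<in>UNIV. \<Sum>b\<in>UNIV. g_up F a b z * g_lo F b a z) = real CARD('n)"
    by (simp add: g_up_g_lo[OF z] kdelta_def)
  have tr_y: "(\<Sum>a\<in>UNIV. \<Sum>b\<in>UNIV. g_up F a b z * (y_lo F a z * y_lo F b z)) = F z"
  proof -
    have "(\<Sum>a\<in>UNIV. \<Sum>b\<in>UNIV. g_up F a b z * (y_lo F a z * y_lo F b z))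
        = (\<Sum>a\<in>UNIV. y_lo F a z * (\<Sum>b\<in>UNIV. g_up F a b z * y_lo F b z))"
      by (simp add: sum_distrib_left mult_ac)
    then show ?thesis by (simp add: raise_y_lo[OF z] y_lo_contract[OF z])
  qed
  have "(\<Sum>a\<in>UNIV. \<Sum>b\<in>UNIV. g_up F a b z * Q $ a $ b)
      = 2 * M * (\<Sum>a\<in>UNIV. \<Sum>b\<in>UNIV. g_up F a b z * g_lo F b a z) - 2 * \<eta> z * H
        - 2 * \<kappa>\<^sup>2 * (\<Sum>a\<in>UNIV. \<Sum>b\<in>UNIV. g_up F a b z * (y_lo F a z * y_lo F b z))"
    unfolding Qab H_def
    by (simp only: right_diff_distrib sum_subtractf sum_distrib_left mult_ac)
  also have "\<dots> = 2 * M * real CARD('n) - 2 * \<eta> z * H - 2 * \<kappa>\<^sup>2 * F z"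
    by (simp only: tr_g tr_y)
  also have "\<dots> = 2 * M"
  proof -
    have "H = (real CARD('n) - 2) * \<eta> z / F z" using H Fz by (simp add: field_simps)
    then have "\<eta> z * H = (real CARD('n) - 2) * M" by (simp add: M_def power2_eq_square)
    moreover have "\<kappa>\<^sup>2 * F z = M" using Fz by (simp add: M_def \<kappa>_def power2_eq_square)
    ultimately show ?thesis by (simp add: mult.assoc algebra_simps)
  qed
  finally show False using trace nz Fz by (simp add: M_def divide_le_0_iff)
qed

text \<open>The extensions of \<open>F\<close> and of the connection provide an extension of \<open>Z\<close>, hence of \<open>\<eta>\<close> and of
  \<open>s = divergence F (gradient F \<eta>)\<close>, to a neighbourhood of the boundary point. By \<open>eta_equation\<close>, \<open>\<eta>\<close>
  is \<open>F s / (n - 2)\<close>; this is where the dimension must exceed 2. So \<open>\<eta>\<^sup>2 / F\<close> is a constant multiple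
  of \<open>F s\<^sup>2\<close>, which tends to 0 with \<open>F\<close>.\<close>

lemma ratio_tendsto_zero_at_boundary:
  assumes n: "CARD('n) \<ge> 3" and W: "open W" "z0 \<in> W"
    and F': "smooth_on F' W" "F' z0 = 0" "invertible (gmat F' z0)" "\<And>z. z \<in> R \<inter> W \<Longrightarrow> F' z = F z"
    and N': "\<And>k i. smooth_on (N' k i) W"
      "\<And>k i z. z \<in> R \<inter> W \<Longrightarrow> N' k i z = conn F k i z + dy i (Z k) z"
  shows "((\<lambda>z. (\<eta> z)\<^sup>2 / F z) \<longlongrightarrow> 0) (at z0 within R)"
proof -
  define V where "V = W \<inter> (\<lambda>z. det (gmat F' z)) -` (- {0})"
  have "smooth_on (\<lambda>z. det (gmat F' z)) W"
  proof (rule smooth_on_det[OF W(1)])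
    show "smooth_on (\<lambda>z. gmat F' z $ i $ j) W" for i j
      unfolding gmat_def using W(1) F'(1) by (simp, intro smooth_on_divide smooth_intros) auto
  qed
  then have "open V"
    unfolding V_def using W(1) smooth_on_imp_continuous_on by (intro continuous_open_preimage) auto
  have V: "V \<subseteq> W" "z0 \<in> V" "\<And>z. z \<in> V \<Longrightarrow> invertible (gmat F' z)"
    using F'(3) W(2) by (auto simp: V_def invertible_det_nz)
  interpret V: metric_chart V F'
    using \<open>open V\<close> smooth_on_subset[OF F'(1) V(1)] V(3) by unfold_locales
  have RV: "open (R \<inter> V)" using open_R \<open>open V\<close> by blast
  have FF: "F' z = F z" if "z \<in> R \<inter> V" for z using that V(1) F'(4) by blast
  \<comment> \<open>Only the difference of the connections is known to extend; Euler's relation recovers \<open>Z\<close>.\<close>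
  define Z' where "Z' k z = 1/2 * (\<Sum>i\<in>UNIV. (N' k i z - conn F' k i z) * snd z $ i)" for k z
  have smZ': "smooth_on (Z' k) V" for k
    unfolding Z'_def using smooth_on_subset[OF N'(1) V(1)]
    by (intro smooth_intros \<open>open V\<close> V.smooth_conn)
  have ZZ: "Z' k z = Z k z" if "z \<in> R \<inter> V" for k z
  proof -
    have "N' k i z - conn F' k i z = dy i (Z k) z" for i
      using N'(2)[of z k i] that V(1) conn_cong[OF RV that FF] by auto
    moreover have "(\<Sum>i\<in>UNIV. dy i (Z k) z * snd z $ i) = 2 * Z k z"
      using euler_homogeneous[OF open_R smooth_Z homogeneous_Z] that by simp
    ultimately show ?thesis by (simp add: Z'_def)
  qed
  define \<eta>' where "\<eta>' = potential F' Z'"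
  have ee: "\<eta>' z = \<eta> z" if "z \<in> R \<inter> V" for z
    using divergence_cong[OF RV that FF ZZ] by (simp add: \<eta>'_def potential_def)
  define s where "s = divergence F' (gradient F' \<eta>')"
  have ss: "s z = divergence F (gradient F \<eta>) z" if "z \<in> R \<inter> V" for z
    unfolding s_def by (rule divergence_cong[OF RV that FF gradient_cong[OF RV _ FF ee]])
  define c where "c = (real CARD('n) - 2)\<^sup>2"
  have "c \<noteq> 0" using n by (simp add: c_def)
  have ratio: "F' z * (s z)\<^sup>2 / c = (\<eta> z)\<^sup>2 / F z" if "z \<in> R \<inter> V" for z
  proof -
    have "F z > 0" using F_pos that by blast
    moreover have "(real CARD('n) - 2) * \<eta> z = F z * s z"
      using eta_equation[of z] ss[OF that] that by simp
    then have "c * (\<eta> z)\<^sup>2 = (F z)\<^sup>2 * (s z)\<^sup>2"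
      unfolding c_def by (metis power_mult_distrib)
    ultimately show ?thesis
      using \<open>c \<noteq> 0\<close> FF[OF that] by (simp add: field_simps power2_eq_square)
  qed
  have "smooth_on s V"
    unfolding s_def \<eta>'_def by (intro V.smooth_divergence V.smooth_gradient V.smooth_potential smZ')
  then have "continuous_on V (\<lambda>z. F' z * (s z)\<^sup>2 / c)"
    using V.smooth_F \<open>c \<noteq> 0\<close> by (intro continuous_intros smooth_on_imp_continuous_on) auto
  then have "((\<lambda>z. F' z * (s z)\<^sup>2 / c) \<longlongrightarrow> F' z0 * (s z0)\<^sup>2 / c) (at z0)"
    using \<open>open V\<close> V(2) by (simp add: continuous_on_eq_continuous_at isCont_def)
  then have "((\<lambda>z. F' z * (s z)\<^sup>2 / c) \<longlongrightarrow> 0) (at z0 within R)"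
    using F'(2) tendsto_within_subset[of _ _ z0 UNIV R] by simp
  moreover have "\<forall>\<^sub>F z in at z0 within R. F' z * (s z)\<^sup>2 / c = (\<eta> z)\<^sup>2 / F z"
    using \<open>open V\<close> V(2) ratio by (auto simp: eventually_at_topological)
  ultimately show ?thesis by (rule Lim_transform_eventually)
qed

lemma fibre_nonzero: "(x, y) \<in> R \<Longrightarrow> y \<noteq> 0"
  using homogeneousD[OF homogeneous_F, of x y 2] F_pos[of "(x, y)"] by auto

text \<open>Since \<open>\<eta>\<^sup>2 / F\<close> has degree 0 and tends to 0 at the boundary of the cone, a positive value at some
  point would force it to attain its maximum over the fibre, against \<open>no_interior_maximum\<close>.\<close>

lemma eta_vanishes:
  assumes lorentz: "\<And>z. z \<in> R \<Longrightarrow> lorentzian (gmat F z)"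
    and boundary: "\<And>y. (x, y) \<in> closure R \<Longrightarrow> (x, y) \<notin> R \<Longrightarrow> y \<noteq> 0 \<Longrightarrow>
      ((\<lambda>z. (\<eta> z)\<^sup>2 / F z) \<longlongrightarrow> 0) (at (x, y) within R)"
    and xy: "(x, y1) \<in> R"
  shows "\<eta> (x, y1) = 0"
proof (rule ccontr)
  assume nz: "\<eta> (x, y1) \<noteq> 0"
  define w where "w y = (\<eta> (x, y))\<^sup>2 / F (x, y)" for y
  have w_scale: "w (t *\<^sub>R y) = w y" if "(x, y) \<in> R" "t > 0" for t y
    using that homogeneousD[OF homogeneous_F that] homogeneousD[OF homogeneous_eta that]
    by (simp add: w_def power_mult_distrib)
  have scale: "(x, t *\<^sub>R y) \<in> R" if "(x, y) \<in> R" "t > 0" for t y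
    using conic_R that by (auto simp: conic_def)
  have contR: "continuous_on R (\<lambda>z. (\<eta> z)\<^sup>2 / F z)"
    using smooth_on_imp_continuous_on[OF smooth_eta] smooth_on_imp_continuous_on[OF smooth_F] F_pos
    by (intro continuous_intros) force+
  have w1: "w y1 > 0" using nz F_pos[OF xy] by (simp add: w_def)
  \<comment> \<open>The lower bound on \<open>w\<close> keeps this part of the unit sphere away from the boundary of the cone,
    which makes it compact.\<close>
  define S where "S = {y. norm y = 1 \<and> (x, y) \<in> R \<and> w y \<ge> w y1}"
  have contS: "continuous_on S w"
  proof -
    have "continuous_on S (\<lambda>y. (x, y))" by (intro continuous_intros)
    from continuous_on_compose2[OF contR this] show ?thesis
      unfolding w_def S_def by auto
  qed
  have "closed S"
    unfolding closed_sequential_limits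
  proof (intro allI impI, elim conjE)
    fix u l
    assume u: "\<forall>n. u n \<in> S" and lim: "u \<longlonglongrightarrow> l"
    have "(\<lambda>n. norm (u n)) \<longlonglongrightarrow> norm l" using lim by (rule tendsto_norm)
    then have l1: "norm l = 1" using u by (simp add: S_def LIMSEQ_const_iff)
    have limx: "(\<lambda>n. (x, u n)) \<longlonglongrightarrow> (x, l)" by (intro tendsto_intros lim)
    have uR: "(x, u n) \<in> R" "w y1 \<le> w (u n)" for n using u by (auto simp: S_def)
    have "((\<lambda>n. w (u n)) \<longlonglongrightarrow> 0)" if "(x, l) \<notin> R"
    proof -
      have "(x, l) \<in> closure R" using limx uR(1) unfolding closure_sequential by (intro exI[of _ "\<lambda>n. (x, u n)"]) simp
      then have "((\<lambda>z. (\<eta> z)\<^sup>2 / F z) \<longlongrightarrow> 0) (at (x, l) within R)"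
        using boundary that l1 by force
      moreover have "filterlim (\<lambda>n. (x, u n)) (at (x, l) within R) sequentially"
        using limx uR that by (auto simp: filterlim_at intro!: always_eventually)
      ultimately show ?thesis unfolding w_def by (rule filterlim_compose)
    qed
    moreover have "\<not> (\<lambda>n. w (u n)) \<longlonglongrightarrow> 0"
      using uR(2) w1 LIMSEQ_le_const[of "\<lambda>n. w (u n)" 0 "w y1"] by fastforce
    ultimately have lR: "(x, l) \<in> R" by blast
    have "(\<lambda>n. w (u n)) \<longlonglongrightarrow> w l"
      unfolding w_def using uR(1) by (intro continuous_on_tendsto_compose[OF contR limx lR]) simp
    then have "w y1 \<le> w l" using uR(2) by (intro LIMSEQ_le_const) auto
    then show "l \<in> S" using l1 lR by (simp add: S_def)
  qed
  moreover have "bounded S" unfolding S_def bounded_iff by auto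
  ultimately have "compact S" by (simp add: compact_eq_bounded_closed)
  have "sgn y1 \<in> S"
  proof -
    have "inverse (norm y1) > 0" using fibre_nonzero[OF xy] by simp
    then show ?thesis
      using scale[OF xy] w_scale[OF xy] fibre_nonzero[OF xy] by (simp add: S_def sgn_div_norm)
  qed
  then obtain y0 where y0: "y0 \<in> S" "\<And>y. y \<in> S \<Longrightarrow> w y \<le> w y0"
    using continuous_attains_sup[OF \<open>compact S\<close> _ contS] by blast
  have y0R: "(x, y0) \<in> R" and "w y0 > 0" using y0(1) w1 by (auto simp: S_def)
  have glob: "w y \<le> w y0" if "(x, y) \<in> R" for y
  proof (cases "w y \<ge> w y1")
    case True
    have "inverse (norm y) > 0" using fibre_nonzero[OF that] by simp
    then have "inverse (norm y) *\<^sub>R y \<in> S"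
      using scale[OF that] w_scale[OF that] fibre_nonzero[OF that] True by (simp add: S_def)
    from y0(2)[OF this] show ?thesis
      using w_scale[OF that \<open>inverse (norm y) > 0\<close>] by simp
  next
    case False
    then show ?thesis using y0(1) by (simp add: S_def)
  qed
  show False
  proof (rule no_interior_maximum[OF y0R lorentz[OF y0R]])
    show "\<eta> (x, y0) \<noteq> 0" using \<open>w y0 > 0\<close> by (auto simp: w_def)
    fix y assume "(fst (x, y0), y) \<in> R"
    then show "(\<eta> (fst (x, y0), y))\<^sup>2 * F (x, y0) \<le> (\<eta> (x, y0))\<^sup>2 * F (fst (x, y0), y)"
      using glob[of y] F_pos[OF y0R] F_pos[of "(x, y)"] by (simp add: w_def divide_simps mult.commute split: if_splits)
  qed
qed

end

section \<open>Boundary points in induced charts\<close>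

lemma local_expr_tchart:
  assumes "smooth_atlas \<A>" "\<phi> \<in> \<A>" "v \<in> tangent_bundle \<A>" "fst v \<in> fst \<phi>"
  shows "local_expr \<A> \<phi> f (tchart \<phi> v) = f v"
  unfolding local_expr_def using inv_into_f_f[OF inj_on_tchart[OF assms(1,2)]] assms(3,4) by simp

lemma jacobian_eq:
  fixes f :: "real ^ 'n \<Rightarrow> real ^ 'n"
  assumes "(f has_derivative (\<lambda>h. M *v h)) (at x)"
  shows "jacobian f (at x) = M"
  unfolding jacobian_def frechet_derivative_at[OF assms, symmetric]
  by (rule matrix_of_matrix_vector_mul)

lemma transition_apply:
  assumes "smooth_atlas \<A>" "\<phi> \<in> \<A>" "q \<in> fst \<phi>"
  shows "transition \<phi> \<psi> (snd \<phi> q) = snd \<psi> q"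
proof -
  have "homeomorphism (fst \<phi>) (snd \<phi> ` fst \<phi>) (snd \<phi>) (inv_into (fst \<phi>) (snd \<phi>))"
    using assms unfolding smooth_atlas_def by blast
  then have "inv_into (fst \<phi>) (snd \<phi>) (snd \<phi> q) = q"
    using assms(3) by (rule homeomorphism_apply1)
  then show ?thesis by (simp add: transition_def)
qed

lemma open_chart_image:
  assumes "smooth_atlas \<A>" "\<phi> \<in> \<A>" "open U" "U \<subseteq> fst \<phi>"
  shows "open (snd \<phi> ` U)"
proof -
  have "homeomorphism (fst \<phi>) (snd \<phi> ` fst \<phi>) (snd \<phi>) (inv_into (fst \<phi>) (snd \<phi>))"
    and "open (fst \<phi>)" "open (snd \<phi> ` fst \<phi>)"
    using assms unfolding smooth_atlas_def by blast+
  then have "openin (top_of_set (snd \<phi> ` fst \<phi>)) (snd \<phi> ` U)"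
    using assms(3,4) by (intro homeomorphism_imp_open_map) (auto simp: openin_open_eq)
  then show ?thesis using \<open>open (snd \<phi> ` fst \<phi>)\<close> openin_open_trans by blast
qed

lemma transition_has_derivative:
  assumes "smooth_atlas \<A>" "\<phi> \<in> \<A>" "\<psi> \<in> \<A>" "p \<in> fst \<phi>" "p \<in> fst \<psi>"
  shows "(transition \<phi> \<psi> has_derivative (\<lambda>h. trans_jac \<phi> \<psi> p *v h)) (at (snd \<phi> p))"
proof -
  have "smooth_on (transition \<phi> \<psi>) (snd \<phi> ` (fst \<phi> \<inter> fst \<psi>))"
    using assms unfolding smooth_atlas_def by blast
  then have "transition \<phi> \<psi> differentiable (at (snd \<phi> p))"
    using assms(4,5) by (intro smooth_on_imp_differentiable) auto
  then show ?thesis unfolding trans_jac_def using jacobian_works by blast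
qed

text \<open>The chain rule for transition maps. It makes the Jacobians applied to a fixed component vector
  a tangent vector, so that every pair of a point and a component vector in a chart is realised.\<close>

lemma trans_jac_cocycle:
  assumes A: "smooth_atlas \<A>" and in_A: "\<phi> \<in> \<A>" "\<psi> \<in> \<A>" "\<rho> \<in> \<A>"
    and p: "p \<in> fst \<phi>" "p \<in> fst \<psi>" "p \<in> fst \<rho>"
  shows "trans_jac \<phi> \<rho> p = trans_jac \<psi> \<rho> p ** trans_jac \<phi> \<psi> p"
proof -
  let ?U = "fst \<phi> \<inter> fst \<psi>"
  have "open ?U" using A in_A unfolding smooth_atlas_def by blast
  then have U: "open (snd \<phi> ` ?U)" using open_chart_image[OF A in_A(1)] by blast
  have "(transition \<psi> \<rho> has_derivative (\<lambda>h. trans_jac \<psi> \<rho> p *v h)) (at (transition \<phi> \<psi> (snd \<phi> p)))"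
    using transition_has_derivative[OF A in_A(2,3) p(2,3)] transition_apply[OF A in_A(1) p(1)] by simp
  from has_derivative_compose[OF transition_has_derivative[OF A in_A(1,2) p(1,2)] this]
  have "((\<lambda>u. transition \<psi> \<rho> (transition \<phi> \<psi> u)) has_derivative
      (\<lambda>h. (trans_jac \<psi> \<rho> p ** trans_jac \<phi> \<psi> p) *v h)) (at (snd \<phi> p))"
    by (simp add: matrix_vector_mul_assoc)
  then have "(transition \<phi> \<rho> has_derivative
      (\<lambda>h. (trans_jac \<psi> \<rho> p ** trans_jac \<phi> \<psi> p) *v h)) (at (snd \<phi> p))"
    by (rule has_derivative_transform_within_open[OF _ U])
       (use p in \<open>auto simp: transition_apply[OF A in_A(1)] transition_apply[OF A in_A(2)]\<close>)
  then show ?thesis unfolding trans_jac_def by (rule jacobian_eq)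
qed

lemma trans_jac_self:
  assumes A: "smooth_atlas \<A>" "\<phi> \<in> \<A>" and p: "p \<in> fst \<phi>"
  shows "trans_jac \<phi> \<phi> p = mat 1"
proof -
  have "open (snd \<phi> ` fst \<phi>)" using A unfolding smooth_atlas_def by blast
  then have "(transition \<phi> \<phi> has_derivative (\<lambda>h. mat 1 *v h)) (at (snd \<phi> p))"
    by (rule has_derivative_transform_within_open[of "\<lambda>u. u", rotated])
       (use p in \<open>auto simp: transition_apply[OF A]\<close>)
  then show ?thesis unfolding trans_jac_def by (rule jacobian_eq)
qed

lemma tangent_vector_exists:
  assumes A: "smooth_atlas \<A>" "\<phi> \<in> \<A>" and p: "p \<in> fst \<phi>"
  obtains v where "v \<in> tangent_bundle \<A>" "fst v = p" "snd v \<phi> = y"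
proof
  define v where "v = (p, \<lambda>\<psi>. if \<psi> \<in> \<A> \<and> p \<in> fst \<psi> then trans_jac \<phi> \<psi> p *v y else 0)"
  show "v \<in> tangent_bundle \<A>"
    unfolding v_def tangent_bundle_def
    by (simp add: matrix_vector_mul_assoc)
       (use trans_jac_cocycle[OF A] p in \<open>metis IntD1 IntD2\<close>)
  show "fst v = p" by (simp add: v_def)
  show "snd v \<phi> = y" using A p by (simp add: v_def trans_jac_self)
qed

lemma region_tangent_bundle:
  assumes "smooth_atlas \<A>" "\<phi> \<in> \<A>"
  shows "region \<phi> (tangent_bundle \<A>) = (snd \<phi> ` fst \<phi>) \<times> UNIV"
proof -
  have "(snd \<phi> p, y) \<in> region \<phi> (tangent_bundle \<A>)" if "p \<in> fst \<phi>" for p y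
  proof -
    obtain v where "v \<in> tangent_bundle \<A>" "fst v = p" "snd v \<phi> = y"
      using tangent_vector_exists[OF assms \<open>p \<in> fst \<phi>\<close>] by blast
    then show ?thesis
      using that unfolding region_def by (intro image_eqI[of _ _ v]) (auto simp: tchart_def)
  qed
  then show ?thesis by (auto simp: region_def tchart_def)
qed

lemma topspace_tangent_topology:
  assumes A: "smooth_atlas \<A>"
  shows "topspace (tangent_topology \<A>) = tangent_bundle \<A>"
proof
  show "topspace (tangent_topology \<A>) \<subseteq> tangent_bundle \<A>"
    using openin_tangent_topology[OF A] openin_topspace by blast
  have "open ((snd \<phi> ` fst \<phi>) \<times> (UNIV :: (real ^ 'b) set))" if "\<phi> \<in> \<A>" for \<phi>
    using A that unfolding smooth_atlas_def by (intro open_Times open_UNIV) blast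
  then have "openin (tangent_topology \<A>) (tangent_bundle \<A>)"
    using openin_tangent_topology[OF A] region_tangent_bundle[OF A] by simp
  then show "tangent_bundle \<A> \<subseteq> topspace (tangent_topology \<A>)" by (rule openin_subset)
qed

text \<open>The closure of \<open>W\<close> is taken in the tangent bundle, whereas limits are computed in a chart;
  this lemma turns the latter into points of the former.\<close>

lemma slit_boundary_point_exists:
  assumes A: "smooth_atlas \<A>" "\<phi> \<in> \<A>" and W: "W \<subseteq> tangent_bundle \<A>"
    and p: "p \<in> fst \<phi>" and y: "y \<noteq> 0"
    and cl: "(snd \<phi> p, y) \<in> closure (region \<phi> W)" and notin: "(snd \<phi> p, y) \<notin> region \<phi> W"
  obtains v where "v \<in> slit_boundary \<A> W" "fst v = p" "tchart \<phi> v = (snd \<phi> p, y)"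
proof -
  obtain v where v: "v \<in> tangent_bundle \<A>" "fst v = p" "snd v \<phi> = y"
    using tangent_vector_exists[OF A p] by blast
  have tv: "tchart \<phi> v = (snd \<phi> p, y)" using v by (simp add: tchart_def)
  have "\<exists>w. w \<in> W \<and> w \<in> T" if T: "v \<in> T" "openin (tangent_topology \<A>) T" for T
  proof -
    have T': "T \<subseteq> tangent_bundle \<A>" "open (region \<phi> T)"
      using T openin_tangent_topology[OF A(1)] A(2) by auto
    have "(snd \<phi> p, y) \<in> region \<phi> T"
      unfolding region_def using T(1) v p tv by (intro image_eqI[of _ _ v]) auto
    then obtain z where "z \<in> region \<phi> T" "z \<in> region \<phi> W"
      using cl open_Int_closure_eq_empty[OF T'(2), of "region \<phi> W"] by blast
    then obtain t w where "t \<in> T" "w \<in> W" "fst t \<in> fst \<phi>" "fst w \<in> fst \<phi>" "tchart \<phi> t = tchart \<phi> w"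
      unfolding region_def image_iff by (metis (lifting) mem_Collect_eq)
    moreover from this have "t \<in> tangent_bundle \<A>" "w \<in> tangent_bundle \<A>" using T'(1) W by blast+
    ultimately have "t = w" using inj_onD[OF inj_on_tchart[OF A]] by blast
    then show ?thesis using \<open>t \<in> T\<close> \<open>w \<in> W\<close> by blast
  qed
  then have "v \<in> tangent_topology \<A> closure_of W"
    using v(1) topspace_tangent_topology[OF A(1)] by (auto simp: in_closure_of)
  moreover have "v \<in> slit_tangent_bundle \<A>" using v y by (auto simp: slit_tangent_bundle_def)
  moreover have "v \<notin> W"
    using notin p v tv unfolding region_def by (metis (mono_tags, lifting) image_eqI mem_Collect_eq)
  ultimately have "v \<in> slit_boundary \<A> W" by (simp add: slit_boundary_def slit_closure_def)
  then show thesis using that v(2) tv by blast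
qed

section \<open>Vanishing of the mean Landsberg tensor\<close>

theorem theorem5p14:
  fixes \<A> :: "('m::{t2_space, second_countable_topology}, 'n::finite) chart set"
    and A :: "('m, 'n) tvec set"
    and L :: "('m, 'n) tvec \<Rightarrow> real"
    and N :: "('m, 'n) chart \<Rightarrow> 'n \<Rightarrow> 'n \<Rightarrow> 'n fld"
    and Z :: "('m, 'n) chart \<Rightarrow> 'n \<Rightarrow> 'n fld"
  assumes "smooth_atlas \<A>"
    and "connected (UNIV :: 'm set)"
    and "CARD('n) \<ge> 3"
    and "cone_domain \<A> A"
    and "lorentz_finsler \<A> A L"
    and "aniso_vector \<A> A 2 Z"
    and "\<forall>\<phi>\<in>\<A>. \<forall>z\<in>region \<phi> A. \<forall>k i.
           N \<phi> k i z = conn (local_expr \<A> \<phi> L) k i z + dy i (Z \<phi> k) z"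
    and "symmetric_connection \<A> A N"
    and "proper_affine_solution \<A> A L N"
    and "\<forall>\<phi>\<in>\<A>. \<forall>z\<in>region \<phi> A. \<forall>i.
           2 * (\<Sum>a\<in>UNIV. dy i (mean_cartan (local_expr \<A> \<phi> L) a) z * Z \<phi> a z)
           + (\<Sum>a\<in>UNIV. mean_cartan (local_expr \<A> \<phi> L) a z * dy i (Z \<phi> a) z)
           + mean_landsberg (local_expr \<A> \<phi> L) i z = 0"
  shows "\<forall>\<phi>\<in>\<A>. \<forall>z\<in>region \<phi> A.
           (\<forall>k. Z \<phi> k z = 0) \<and> (\<forall>i. mean_landsberg (local_expr \<A> \<phi> L) i z = 0)"
proof
  fix \<phi> assume phi: "\<phi> \<in> \<A>"
  note atlas = assms(1)
  define R where "R = region \<phi> A"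
  define F where "F = local_expr \<A> \<phi> L"
  have A_open: "openin (tangent_topology \<A>) A" and A_slit: "A \<subseteq> slit_tangent_bundle \<A>"
    and A_conic: "\<And>v t. v \<in> A \<Longrightarrow> t > 0 \<Longrightarrow> scale_tvec t v \<in> A"
    using assms(4) unfolding cone_domain_def by blast+
  have A_tangent: "A \<subseteq> tangent_bundle \<A>"
    using A_slit by (auto simp: slit_tangent_bundle_def)
  have proper: "proper_finsler \<A> A L" and lorentz: "\<And>z. z \<in> R \<Longrightarrow> lorentzian (gmat F z)"
    using assms(5) phi unfolding lorentz_finsler_def R_def F_def by blast+
  have finsler: "pseudo_finsler \<A> A L" and L_pos: "\<And>v. v \<in> A \<Longrightarrow> L v > 0"
    using proper unfolding proper_finsler_def by blast+
  have R_point: thesis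
    if "z \<in> R" "\<And>v. v \<in> A \<Longrightarrow> v \<in> tangent_bundle \<A> \<Longrightarrow> fst v \<in> fst \<phi> \<Longrightarrow> z = tchart \<phi> v \<Longrightarrow> thesis"
    for z thesis
    using that A_tangent unfolding R_def region_def by blast
  have F_tchart: "F (tchart \<phi> v) = L v" if "v \<in> A" "fst v \<in> fst \<phi>" for v
    unfolding F_def using that A_tangent by (intro local_expr_tchart[OF atlas phi]) auto
  have scale_point: "(x, t *\<^sub>R y) \<in> R \<and> F (x, t *\<^sub>R y) = t\<^sup>2 * F (x, y)"
    if "(x, y) \<in> R" "t > 0" for x y t
  proof -
    obtain v where v: "v \<in> A" "fst v \<in> fst \<phi>" "(x, y) = tchart \<phi> v"
      using \<open>(x, y) \<in> R\<close> by (rule R_point)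
    have sv: "scale_tvec t v \<in> A" "fst (scale_tvec t v) \<in> fst \<phi>"
      "(x, t *\<^sub>R y) = tchart \<phi> (scale_tvec t v)"
      using A_conic[OF v(1) that(2)] v by (auto simp: scale_tvec_def tchart_def)
    moreover have "L (scale_tvec t v) = t\<^sup>2 * L v"
      using finsler v(1) that(2) unfolding pseudo_finsler_def by blast
    ultimately show ?thesis
      using v F_tchart unfolding R_def region_def by auto
  qed
  have Z_smooth: "smooth_on (Z \<phi> k) R" and "pos_homogeneous 2 R (Z \<phi> k)" for k
    using assms(6) phi unfolding aniso_vector_def R_def by blast+
  then have Z_hom: "homogeneous 2 R (Z \<phi> k)" for k
    using pos_homogeneous_imp_homogeneous[of 2 R "Z \<phi> k"] by simp
  interpret cone_chart R F
  proof
    show "open R"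
      using A_open openin_tangent_topology[OF atlas] phi unfolding R_def by blast
    show "smooth_on F R"
      using finsler phi unfolding pseudo_finsler_def smooth_fun_def R_def F_def by blast
    show "invertible (gmat F z)" if "z \<in> R" for z
      using finsler phi that unfolding pseudo_finsler_def R_def F_def by blast
    show "conic R" using scale_point unfolding conic_def by blast
    show "homogeneous 2 R F" using scale_point unfolding homogeneous_def by simp
  qed
  have F_pos: "F z > 0" if "z \<in> R" for z
    using R_point[OF that] F_tchart L_pos by metis
  have nonzero: "snd z \<noteq> 0" if "z \<in> R" for z
  proof
    assume "snd z = 0"
    then have "F z = 2\<^sup>2 * F z" using scale_point[of "fst z" "snd z" 2] that by (cases z) auto
    with F_pos[OF that] show False by simp
  qed
  have "\<exists>J. \<forall>\<phi>\<in>\<A>. \<forall>z\<in>region \<phi> A.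
      (\<forall>k i. N \<phi> k i z = conn (local_expr \<A> \<phi> L) k i z + J \<phi> k i z) \<and>
      affine_equation_at (local_expr \<A> \<phi> L) (J \<phi>) z"
    using assms(9) unfolding proper_affine_solution_def affine_solution_def by blast
  then obtain J where "\<forall>z\<in>R. (\<forall>k i. N \<phi> k i z = conn F k i z + J \<phi> k i z) \<and> affine_equation_at F (J \<phi>) z"
    using phi unfolding R_def F_def by blast
  then have J: "\<And>z. z \<in> R \<Longrightarrow> affine_equation_at F (J \<phi>) z"
    "\<And>z k i. z \<in> R \<Longrightarrow> N \<phi> k i z = conn F k i z + J \<phi> k i z"
    by blast+
  have N: "N \<phi> k i z = conn F k i z + dy i (Z \<phi> k) z" if "z \<in> R" for k i z
    using assms(7) phi that unfolding R_def F_def by blast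
  have lan: "2 * (\<Sum>a\<in>UNIV. dy i (mean_cartan F a) z * Z \<phi> a z)
      + (\<Sum>a\<in>UNIV. mean_cartan F a z * dy i (Z \<phi> a) z) + mean_landsberg F i z = 0"
    if "z \<in> R" for i z
    using assms(10) phi that unfolding R_def F_def by blast
  interpret reduced_equation R F "Z \<phi>"
  proof
    show "(\<Sum>a\<in>UNIV. y_lo F a z * dy b (Z \<phi> a) z) = 2 * F z * dy b (potential F (Z \<phi>)) z"
      if z: "z \<in> R" for z b
    proof (rule affine_imp_reduced[OF _ Z_smooth _ _ J(1)[OF z] z nonzero[OF z] lan[OF z]])
      show "CARD('n) \<ge> 2" using assms(3) by simp
      show "F z \<noteq> 0" using F_pos[OF z] by simp
      show "J \<phi> k i w = dy i (Z \<phi> k) w" if "w \<in> R" for w k i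
        using J(2)[OF that, of k i] N[OF that, of k i] by simp
    qed
  qed (use F_pos Z_smooth Z_hom in auto)
  obtain A' L' where A': "openin (tangent_topology \<A>) A'" "slit_closure \<A> A \<subseteq> A'"
    and L': "smooth_fun \<A> A' L'" "\<forall>v\<in>A. L' v = L v" "\<forall>v\<in>slit_boundary \<A> A. L' v = 0"
      "\<forall>\<phi>\<in>\<A>. \<forall>z\<in>region \<phi> (slit_boundary \<A> A). invertible (gmat (local_expr \<A> \<phi> L') z)"
    using proper unfolding proper_finsler_def by (elim conjE exE) (rule that)
  obtain A'' N' where A'': "openin (tangent_topology \<A>) A''" "slit_closure \<A> A \<subseteq> A''"
    and N': "nonlinear_connection \<A> A'' N'"
      "\<forall>\<phi>\<in>\<A>. \<forall>z\<in>region \<phi> A. \<forall>k i. N' \<phi> k i z = N \<phi> k i z"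
    using assms(9) unfolding proper_affine_solution_def by (elim conjE exE) (rule that)
  define W where "W = region \<phi> A' \<inter> region \<phi> A''"
  have "open W"
    using A'(1) A''(1) openin_tangent_topology[OF atlas] phi unfolding W_def by blast
  have boundary: "((\<lambda>z. (potential F (Z \<phi>) z)\<^sup>2 / F z) \<longlongrightarrow> 0) (at (snd \<phi> p, y) within R)"
    if p: "p \<in> fst \<phi>" and y: "(snd \<phi> p, y) \<in> closure R" "(snd \<phi> p, y) \<notin> R" "y \<noteq> 0" for p y
  proof -
    obtain v where v: "v \<in> slit_boundary \<A> A" "fst v = p" "tchart \<phi> v = (snd \<phi> p, y)"
      using slit_boundary_point_exists[OF atlas phi A_tangent p y(3)] y(1,2) unfolding R_def by blast
    have v': "v \<in> slit_closure \<A> A" "v \<in> tangent_bundle \<A>"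
      using v(1) by (auto simp: slit_boundary_def slit_closure_def slit_tangent_bundle_def)
    have in_region: "(snd \<phi> p, y) \<in> region \<phi> B" if "v \<in> B" for B
      unfolding region_def using that v p by (intro image_eqI[of _ _ v]) auto
    show ?thesis
    proof (rule ratio_tendsto_zero_at_boundary[OF assms(3) \<open>open W\<close>, where F' = "local_expr \<A> \<phi> L'" and N' = "N' \<phi>"])
      show "(snd \<phi> p, y) \<in> W" using v' A'(2) A''(2) in_region by (auto simp: W_def)
      have "smooth_on (local_expr \<A> \<phi> L') (region \<phi> A')"
        using L'(1) phi unfolding smooth_fun_def by blast
      then show "smooth_on (local_expr \<A> \<phi> L') W"
        by (rule smooth_on_subset) (simp add: W_def)
      show "local_expr \<A> \<phi> L' (snd \<phi> p, y) = 0"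
        using local_expr_tchart[OF atlas phi v'(2), of L'] v p L'(3) by simp
      show "invertible (gmat (local_expr \<A> \<phi> L') (snd \<phi> p, y))"
        using L'(4) phi in_region[OF v(1)] by blast
      show "local_expr \<A> \<phi> L' z = F z" if z: "z \<in> R \<inter> W" for z
      proof -
        obtain u where u: "u \<in> A" "u \<in> tangent_bundle \<A>" "fst u \<in> fst \<phi>" "z = tchart \<phi> u"
          using R_point[of z] z by blast
        show ?thesis
          using F_tchart[OF u(1,3)] local_expr_tchart[OF atlas phi u(2,3), of L'] L'(2) u(1,4) by simp
      qed
      have "smooth_on (N' \<phi> k i) (region \<phi> A'')" for k i
        using N'(1) phi unfolding nonlinear_connection_def by blast
      then show "smooth_on (N' \<phi> k i) W" for k i
        by (rule smooth_on_subset) (simp add: W_def)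
      show "N' \<phi> k i z = conn F k i z + dy i (Z \<phi> k) z" if "z \<in> R \<inter> W" for k i z
        using N'(2) N phi that unfolding R_def by simp
    qed
  qed
  have eta_zero: "potential F (Z \<phi>) z = 0" if z: "z \<in> R" for z
  proof -
    obtain v where v: "fst v \<in> fst \<phi>" "z = tchart \<phi> v" using R_point[OF z] by blast
    then have "z = (snd \<phi> (fst v), snd v \<phi>)" by (simp add: tchart_def)
    then show ?thesis using eta_vanishes[OF lorentz boundary[OF v(1)]] z by blast
  qed
  have Z_zero: "Z \<phi> k z = 0" if z: "z \<in> R" for z k
  proof -
    have "dy b (potential F (Z \<phi>)) z = dy b (\<lambda>z. 0) z" for b
      by (rule dy_cong[OF open_R z eta_zero])
    then have "gradient F (potential F (Z \<phi>)) k z = 0" by (simp add: gradient_def)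
    then show ?thesis using Z_eq[OF z, of k] eta_zero[OF z] by simp
  qed
  have "mean_landsberg F i z = 0" if z: "z \<in> R" for i z
  proof -
    have "dy i (Z \<phi> a) z = dy i (\<lambda>z. 0) z" for a
      by (rule dy_cong[OF open_R z Z_zero])
    then show ?thesis using lan[OF z, of i] Z_zero[OF z] by simp
  qed
  then show "\<forall>z\<in>region \<phi> A. (\<forall>k. Z \<phi> k z = 0) \<and> (\<forall>i. mean_landsberg (local_expr \<A> \<phi> L) i z = 0)"
    using Z_zero unfolding R_def F_def by blast
qed

end
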